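(* Let $d\ge 4$. For any $K>0$ and $0<\beta<1$ there is $u_0=u_0(d,K,\beta)>0$ such that for every $0<u\le u_0$, $$\lim_{N\to\infty} P\big[\mathcal V_{K,\beta,uN^d}\big]=1,$$ where $\mathcal V_{K,\beta,t}$ denotes the event that for all $x\in E$ and all $1\le j\le d$ there is an integer $0\le m<N^\beta$ such that $$X_{[0,t]}\cap\big\{x+(m+k)e_j:\ k\in\mathbb Z,\ 0\le k\le [K\log N]\big\}=\emptyset .$$
   Context: $[\cdot]$ denotes integer part. For $N\ge1$, $E=(\mathbb Z/N\mathbb Z)^d$ is the discrete torus and $e_1,\dots,e_d$ is the canonical basis of $\mathbb R^d$ (sums $x+ke_j$ with $x\in E$ are understood modulo $N$). $P$ is the law of simple random walk $(X_n)_{n\ge0}$ on $E$ (each step adds one of $\pm e_1,\dots,\pm e_d$ with probability $1/(2d)$) started from the uniform distribution on $E$. For $t\ge0$, $X_{[0,t]}=\{z\in E: X_n=z\text{ for some integer }0\le n\le t\}$. *)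

theory Defs
  imports "HOL-Probability.Probability"
begin

(* (Z/NZ)^d through the representatives 0..N-1 of the residue classes. *)
definition torus :: "nat \<Rightarrow> nat \<Rightarrow> (nat \<Rightarrow> int) set" where
  "torus d N = {1..d} \<rightarrow>\<^sub>E {0..<int N}"

(* Sum of a point of the torus and a vector of Z^d, reduced modulo N. *)
definition torus_add :: "nat \<Rightarrow> nat \<Rightarrow> (nat \<Rightarrow> int) \<Rightarrow> (nat \<Rightarrow> int) \<Rightarrow> (nat \<Rightarrow> int)" where
  "torus_add d N x v = (\<lambda>i\<in>{1..d}. (x i + v i) mod int N)"

definition unit_vec :: "nat \<Rightarrow> nat \<Rightarrow> int" where
  "unit_vec j = (\<lambda>i. if i = j then 1 else 0)"

(* The 2d vectors \<plusminus>e_j are kept in Z^d, where they are distinct also when N = 2. *)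
definition unit_steps :: "nat \<Rightarrow> (nat \<Rightarrow> int) set" where
  "unit_steps d = {(\<lambda>i. c * unit_vec j i) | c j. c \<in> {1, -1} \<and> j \<in> {1..d}}"

(* Simple random walk is built from a uniform starting point and an independent
   i.i.d. sequence of uniform steps; this is the underlying probability space. *)
definition srw_space :: "nat \<Rightarrow> nat \<Rightarrow> ((nat \<Rightarrow> int) \<times> (nat \<Rightarrow> nat \<Rightarrow> int)) measure" where
  "srw_space d N =
     measure_pmf (pmf_of_set (torus d N)) \<Otimes>\<^sub>M
     (\<Pi>\<^sub>M n\<in>(UNIV :: nat set). measure_pmf (pmf_of_set (unit_steps d)))"

primrec srw :: "nat \<Rightarrow> nat \<Rightarrow> nat \<Rightarrow> (nat \<Rightarrow> int) \<times> (nat \<Rightarrow> nat \<Rightarrow> int) \<Rightarrow> (nat \<Rightarrow> int)" where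
  "srw d N 0 \<omega> = fst \<omega>"
| "srw d N (Suc n) \<omega> = torus_add d N (srw d N n \<omega>) (snd \<omega> n)"

definition trajectory ::
  "nat \<Rightarrow> nat \<Rightarrow> real \<Rightarrow> (nat \<Rightarrow> int) \<times> (nat \<Rightarrow> nat \<Rightarrow> int) \<Rightarrow> (nat \<Rightarrow> int) set" where
  "trajectory d N t \<omega> = {z \<in> torus d N. \<exists>n::nat. real n \<le> t \<and> srw d N n \<omega> = z}"

definition segment_at ::
  "nat \<Rightarrow> nat \<Rightarrow> real \<Rightarrow> (nat \<Rightarrow> int) \<Rightarrow> nat \<Rightarrow> int \<Rightarrow> (nat \<Rightarrow> int) set" where
  "segment_at d N K x j m =
     {torus_add d N x (\<lambda>i. (m + k) * unit_vec j i) | k::int. 0 \<le> k \<and> k \<le> \<lfloor>K * ln (real N)\<rfloor>}"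

definition vacant_event ::
  "nat \<Rightarrow> nat \<Rightarrow> real \<Rightarrow> real \<Rightarrow> real \<Rightarrow> ((nat \<Rightarrow> int) \<times> (nat \<Rightarrow> nat \<Rightarrow> int)) set" where
  "vacant_event d N K \<beta> t =
     {\<omega> \<in> space (srw_space d N). \<forall>x\<in>torus d N. \<forall>j\<in>{1..d}. \<exists>m::int.
        0 \<le> m \<and> real_of_int m < real N powr \<beta> \<and>
        trajectory d N t \<omega> \<inter> segment_at d N K x j m = {}}"

lemma finite_torus: "finite (torus d N)"
  unfolding torus_def by (intro finite_PiE) auto

lemma prob_space_srw_space: "prob_space (srw_space d N)"
proof -
  interpret A: prob_space "measure_pmf (pmf_of_set (torus d N))"
    by (rule prob_space_measure_pmf)
  interpret B: product_prob_space "\<lambda>n::nat. measure_pmf (pmf_of_set (unit_steps d))" UNIV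
    by unfold_locales
  interpret AB: pair_prob_space "measure_pmf (pmf_of_set (torus d N))"
    "\<Pi>\<^sub>M n\<in>(UNIV :: nat set). measure_pmf (pmf_of_set (unit_steps d))" ..
  show ?thesis unfolding srw_space_def by (rule AB.prob_space_axioms)
qed

lemma srw_coord_measurable:
  assumes "i \<in> {1..d}"
  shows "(\<lambda>\<omega>. srw d N n \<omega> i) \<in> srw_space d N \<rightarrow>\<^sub>M count_space UNIV"
proof (induction n)
  case 0
  have "(\<lambda>v. v i) \<in> measure_pmf (pmf_of_set (torus d N)) \<rightarrow>\<^sub>M count_space UNIV"
    by simp
  from measurable_compose[OF measurable_fst this] show ?case
    unfolding srw_space_def by simp
next
  case (Suc n)
  have step: "(\<lambda>\<omega>. snd \<omega> n) \<in> srw_space d N \<rightarrow>\<^sub>M measure_pmf (pmf_of_set (unit_steps d))"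
    unfolding srw_space_def
    by (rule measurable_compose[OF measurable_snd measurable_component_singleton]) simp
  have "(\<lambda>v. v i) \<in> measure_pmf (pmf_of_set (unit_steps d)) \<rightarrow>\<^sub>M count_space UNIV"
    by simp
  from measurable_compose[OF step this]
  have "(\<lambda>\<omega>. snd \<omega> n i) \<in> srw_space d N \<rightarrow>\<^sub>M count_space UNIV" .
  from this Suc.IH have "(\<lambda>\<omega>. (srw d N n \<omega> i + snd \<omega> n i) mod int N) \<in> srw_space d N \<rightarrow>\<^sub>M count_space UNIV"
    by measurable
  then show ?case using assms by (simp add: torus_add_def)
qed

lemma srw_eq_measurable:
  assumes "z \<in> torus d N"
  shows "Measurable.pred (srw_space d N) (\<lambda>\<omega>. srw d N n \<omega> = z)"
proof (cases n)
  case 0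
  have "(\<lambda>v. v = z) \<in> measure_pmf (pmf_of_set (torus d N)) \<rightarrow>\<^sub>M count_space UNIV"
    by simp
  from measurable_compose[OF measurable_fst this] show ?thesis
    unfolding srw_space_def 0 by simp
next
  case (Suc k)
  have *: "srw d N n \<omega> = z \<longleftrightarrow> (\<forall>i\<in>{1..d}. srw d N n \<omega> i = z i)" for \<omega>
  proof -
    have "srw d N n \<omega> \<in> extensional {1..d}" by (simp add: Suc torus_add_def)
    moreover have "z \<in> extensional {1..d}" using assms by (auto simp: torus_def PiE_def)
    ultimately show ?thesis by (metis extensionalityI)
  qed
  have "Measurable.pred (srw_space d N) (\<lambda>\<omega>. srw d N n \<omega> i = z i)" if "i \<in> {1..d}" for i
    using measurable_compose[OF srw_coord_measurable[OF that], of "\<lambda>v. v = z i" "count_space UNIV" N n]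
    by simp
  then show ?thesis unfolding * by (intro pred_intros_finite) auto
qed

lemma vacant_event_measurable: "vacant_event d N K \<beta> t \<in> sets (srw_space d N)"
proof -
  have *: "trajectory d N t \<omega> \<inter> S = {} \<longleftrightarrow>
      (\<forall>z\<in>torus d N \<inter> S. \<forall>n. real n \<le> t \<longrightarrow> \<not> srw d N n \<omega> = z)" for \<omega> S
    unfolding trajectory_def by auto
  have "Measurable.pred (srw_space d N) (\<lambda>\<omega>. trajectory d N t \<omega> \<inter> S = {})" for S
    unfolding *
    by (intro pred_intros_finite pred_intros_countable pred_intros_imp' pred_intros_logic
        srw_eq_measurable) (auto simp: finite_torus)
  then have "Measurable.pred (srw_space d N) (\<lambda>\<omega>. \<forall>x\<in>torus d N. \<forall>j\<in>{1..d}. \<exists>m::int.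
        0 \<le> m \<and> real_of_int m < real N powr \<beta> \<and>
        trajectory d N t \<omega> \<inter> segment_at d N K x j m = {})"
    by (intro pred_intros_finite pred_intros_countable pred_intros_conj1' finite_torus) auto
  then show ?thesis unfolding vacant_event_def pred_def .
qed

end

theory Submission
  imports Defs "HOL-Real_Asymp.Real_Asymp"
begin

text \<open>
  Cut the first \<open>N powr \<beta>\<close> points of the line \<open>x + \<int> e\<^sub>j\<close> into \<open>M\<close> disjoint blocks of length about
  \<open>K ln N\<close>; it suffices that, with probability \<open>1 - o(N ^ (-d))\<close>, some block is never hit. The coordinates
  other than the \<open>j\<close>-th determine the times at which the walk is on the line. They perform a lazy walk in
  dimension \<open>d - 1 \<ge> 3\<close>, hence transient, so Khasminskii's lemma gives exponential tails for the number of these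
  times: about \<open>u N\<close> in total, and less than \<open>s = N powr (\<beta> / 4)\<close> in any period of length \<open>s N\<^sup>2\<close>. Consequently
  the visits form clusters of fewer than \<open>s\<close> visits, separated by time gaps of order \<open>N\<^sup>2\<close>.

  Conditionally on these times the \<open>j\<close>-th coordinate is still a simple random walk. During a gap it makes
  at least \<open>N\<^sup>2\<close> steps, after which each of its values modulo \<open>N\<close> has probability at most \<open>4 / N\<close>. So a
  cluster with \<open>v\<close> visits hits on average at most a proportion \<open>v p\<close> of the blocks not hit so far, where
  \<open>p = 4 l / N\<close> with \<open>l\<close> the block length, and never more than \<open>s\<close> of them. As in the coupon collector problem,
  an exponential supermartingale in the number of blocks not hit bounds the probability that all are hit
  by \<open>exp (- (M / s) exp (- 4 p V))\<close>, \<open>V\<close> being the number of visits. Since \<open>p V\<close> is of order \<open>u K ln N\<close>,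
  this is at most \<open>exp (- (N powr (\<beta> / 8)))\<close> for small \<open>u\<close>.
\<close>

section \<open>Averages over words and Khasminskii's lemma\<close>

definition avg :: "'a set \<Rightarrow> ('a \<Rightarrow> real) \<Rightarrow> real" where
  "avg S f = (\<Sum>s\<in>S. f s) / real (card S)"

text \<open>Expectation of \<open>f\<close> over a word of \<open>n\<close> i.i.d. uniform letters.
  Recursion on the first letter makes first-step decompositions definitional, and all estimates stay
  finite computations until \<open>measure_srw_ge\<close> passes to
  \<open>srw_space\<close>.\<close>

primrec wavg :: "'a set \<Rightarrow> nat \<Rightarrow> ('a list \<Rightarrow> real) \<Rightarrow> real" where
  "wavg S 0 f = f []"
| "wavg S (Suc n) f = avg S (\<lambda>s. wavg S n (\<lambda>w. f (s # w)))"

lemma avg_mono: "(\<And>s. s \<in> S \<Longrightarrow> f s \<le> g s) \<Longrightarrow> avg S f \<le> avg S g"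
  unfolding avg_def by (intro divide_right_mono sum_mono) auto

lemma avg_cong: "(\<And>s. s \<in> S \<Longrightarrow> f s = g s) \<Longrightarrow> avg S f = avg S g"
  unfolding avg_def by (metis sum.cong)

lemma avg_const: "finite S \<Longrightarrow> S \<noteq> {} \<Longrightarrow> avg S (\<lambda>_. c) = c"
  by (simp add: avg_def)

lemma avg_add: "avg S (\<lambda>s. f s + g s) = avg S f + avg S g"
  by (simp add: avg_def sum.distrib add_divide_distrib)

lemma avg_cmult: "avg S (\<lambda>s. c * f s) = c * avg S f"
  by (simp add: avg_def sum_distrib_left)

lemma avg_sum: "avg S (\<lambda>s. \<Sum>i\<in>A. f i s) = (\<Sum>i\<in>A. avg S (f i))"
  unfolding avg_def by (subst sum.swap) (simp add: sum_divide_distrib)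

lemma avg_bij: "bij_betw h S S \<Longrightarrow> avg S (\<lambda>s. f (h s)) = avg S f"
  unfolding avg_def by (simp add: sum.reindex_bij_betw)

lemma wavg_mono:
  "(\<And>w. set w \<subseteq> S \<Longrightarrow> length w = n \<Longrightarrow> f w \<le> g w) \<Longrightarrow> wavg S n f \<le> wavg S n g"
  by (induction n arbitrary: f g) (auto intro!: avg_mono)

lemma wavg_cong:
  "(\<And>w. set w \<subseteq> S \<Longrightarrow> length w = n \<Longrightarrow> f w = g w) \<Longrightarrow> wavg S n f = wavg S n g"
  by (intro antisym wavg_mono) auto

lemma wavg_const: "finite S \<Longrightarrow> S \<noteq> {} \<Longrightarrow> wavg S n (\<lambda>_. c) = c"
  by (induction n) (auto simp: avg_const)

lemma wavg_add: "wavg S n (\<lambda>w. f w + g w) = wavg S n f + wavg S n g"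
  by (induction n arbitrary: f g) (auto simp: avg_add)

lemma wavg_cmult: "wavg S n (\<lambda>w. c * f w) = c * wavg S n f"
  by (induction n arbitrary: f) (auto simp: avg_cmult)

lemma wavg_sum: "finite A \<Longrightarrow> wavg S n (\<lambda>w. \<Sum>i\<in>A. f i w) = (\<Sum>i\<in>A. wavg S n (f i))"
  by (induction n arbitrary: f) (auto simp: avg_sum)

lemma wavg_append:
  "wavg S (m + n) f = wavg S m (\<lambda>u. wavg S n (\<lambda>v. f (u @ v)))"
  by (induction m arbitrary: f) auto

lemma wavg_prod_list: "wavg S n (\<lambda>w. prod_list (map h w)) = avg S h ^ n"
proof (induction n)
  case (Suc n)
  have "wavg S (Suc n) (\<lambda>w. prod_list (map h w)) = avg S (\<lambda>s. avg S h ^ n * h s)"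
    by (simp add: wavg_cmult Suc mult.commute)
  then show ?case by (simp only: avg_cmult) simp
qed simp

lemma wavg_upper:
  assumes "finite S" "S \<noteq> {}" "\<And>w. set w \<subseteq> S \<Longrightarrow> length w = n \<Longrightarrow> f w \<le> c"
  shows "wavg S n f \<le> c"
  using wavg_mono[of S n f "\<lambda>_. c"] assms by (simp add: wavg_const)

text \<open>Markov property: given the first \<open>a\<close> letters, the following ones are again
  uniform. The minimum accounts for a segment cut off by the end of the word.\<close>

lemma wavg_segment_le:
  assumes S: "finite S" "S \<noteq> {}" and "a \<le> n"
    and h: "\<And>u. wavg S (min m (n - a)) (h u) \<le> c"
  shows "wavg S n (\<lambda>w. h (take a w) (take m (drop a w))) \<le> c"
proof -
  let ?m = "min m (n - a)"
  have n: "n = a + (?m + (n - a - ?m))" using \<open>a \<le> n\<close> by simp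
  have "wavg S n (\<lambda>w. h (take a w) (take m (drop a w)))
      = wavg S a (\<lambda>u. wavg S ?m (\<lambda>v. wavg S (n - a - ?m)
          (\<lambda>v'. h (take a (u @ v @ v')) (take m (drop a (u @ v @ v'))))))"
    by (subst n) (simp only: wavg_append)
  also have "\<dots> = wavg S a (\<lambda>u. wavg S ?m (\<lambda>v. wavg S (n - a - ?m) (\<lambda>v'. h u v)))"
  proof (intro wavg_cong)
    fix u v v' :: "'a list"
    assume l: "length u = a" "length v = ?m" "length v' = n - a - ?m"
    show "h (take a (u @ v @ v')) (take m (drop a (u @ v @ v'))) = h u v"
      using l by (cases "m \<le> n - a") auto
  qed
  also have "\<dots> \<le> c"
    unfolding wavg_const[OF S] using h by (intro wavg_upper[of S a, OF S])
  finally show ?thesis .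
qed

lemma wavg_eq_sum:
  assumes "finite S"
  shows "wavg S n f = (\<Sum>w | set w \<subseteq> S \<and> length w = n. f w) / real (card S) ^ n"
proof (induction n arbitrary: f)
  case 0
  have "{w. set w \<subseteq> S \<and> length w = 0} = {[]}" by auto
  then show ?case by simp
next
  case (Suc n)
  have eq: "{w. set w \<subseteq> S \<and> length w = Suc n} =
      (\<lambda>(s, w). s # w) ` (S \<times> {w. set w \<subseteq> S \<and> length w = n})"
    by (auto simp: length_Suc_conv image_def) 
  have inj: "inj_on (\<lambda>(s, w). s # w) (S \<times> {w. set w \<subseteq> S \<and> length w = n})"
    by (auto simp: inj_on_def)
  have "(\<Sum>w | set w \<subseteq> S \<and> length w = Suc n. f w) =
      (\<Sum>s\<in>S. \<Sum>w | set w \<subseteq> S \<and> length w = n. f (s # w))"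
    unfolding eq by (subst sum.reindex[OF inj]) (simp add: sum.cartesian_product split_def)
  then show ?case
    by (simp add: Suc avg_def sum_divide_distrib mult.commute)
qed

section \<open>Exponential moments of the number of visits\<close>

text \<open>The position after the last letter is not counted, so that visits add up under
  concatenation.\<close>

primrec visits :: "('b \<Rightarrow> 'a \<Rightarrow> 'b) \<Rightarrow> 'b set \<Rightarrow> 'b \<Rightarrow> 'a list \<Rightarrow> nat" where
  "visits f B x [] = 0"
| "visits f B x (s # w) = of_bool (x \<in> B) + visits f B (f x s) w"

lemma visits_append: "visits f B x (u @ v) = visits f B x u + visits f B (foldl f x u) v"
  by (induction u arbitrary: x) auto

lemma visits_le_length: "visits f B x w \<le> length w"
  by (induction w arbitrary: x) (auto simp: le_SucI)

text \<open>Khasminskii's argument: \<open>(1 + \<eta>) ^ V\<close> is \<open>1\<close> plus \<open>\<eta>\<close> times the sum of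
  \<open>(1 + \<eta>) ^ V'\<close> over the visits, \<open>V'\<close> being the number of later visits.\<close>
lemma wavg_visits_power_le_2:
  fixes f :: "'b \<Rightarrow> 'a \<Rightarrow> 'b"
  assumes S: "finite S" "S \<noteq> {}"
    and green: "\<And>x. (\<Sum>t<n. wavg S t (\<lambda>w. of_bool (foldl f x w \<in> B))) \<le> C"
    and \<eta>: "0 \<le> \<eta>" "\<eta> * C \<le> 1 / 2" and "m \<le> n"
  shows "wavg S m (\<lambda>w. (1 + \<eta>) ^ visits f B x w) \<le> 2"
proof -
  define F where "F = (\<lambda>m x. wavg S m (\<lambda>w. (1 + \<eta>) ^ visits f B x w))"
  define G where "G = (\<lambda>t x. wavg S t (\<lambda>w. of_bool (foldl f x w \<in> B) :: real))"
  have F_Suc: "F (Suc m) x = (1 + \<eta> * of_bool (x \<in> B)) * avg S (\<lambda>s. F m (f x s))" for m x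
    by (simp add: F_def power_add wavg_cmult avg_cmult)
  have G_Suc: "G (Suc t) x = avg S (\<lambda>s. G t (f x s))" for t x
    by (simp add: G_def)
  have F_ge: "1 \<le> F m x" for m x
  proof -
    have "wavg S m (\<lambda>w. 1) \<le> F m x"
      unfolding F_def using \<eta> by (intro wavg_mono) auto
    then show ?thesis using S by (simp add: wavg_const)
  qed
  have F_mono: "F m x \<le> F (Suc m) x" for m x
  proof (induction m arbitrary: x)
    case 0
    show ?case using F_ge[of 1 x] by (simp add: F_def)
  next
    case (Suc m)
    show ?case
      unfolding F_Suc[of "Suc m" x] F_Suc[of m x] using \<eta> Suc by (intro mult_left_mono avg_mono) auto
  qed
  then have F_mono': "k \<le> l \<Longrightarrow> F k x \<le> F l x" for k l x
    using lift_Suc_mono_le[of "\<lambda>m. F m x"] by blast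
  have F_upper: "F m x \<le> (1 + \<eta>) ^ m" for m x
    unfolding F_def using \<eta> S by (intro wavg_upper) (auto intro!: power_increasing visits_le_length intro: order.trans)
  have bdd: "bdd_above (range (F n))" using F_upper[of n] by (rule bdd_aboveI2)
  \<comment> \<open>Supremum over the starting points, finite because a word of length
    \<open>n\<close> has at most \<open>n\<close> visits.\<close>
  define Z where "Z = (SUP x. F n x)"
  have Z: "F m x \<le> Z" if "m \<le> n" for m x
    unfolding Z_def using F_mono'[OF that] cSUP_upper[OF _ bdd, of x] by (force intro: order.trans)
  have Zge: "0 \<le> Z" using Z[of 0 undefined] F_ge[of 0 undefined] by simp
  \<comment> \<open>First-step analysis: a visit at time 0 adds at most \<open>\<eta> * Z\<close>,
    since \<open>Z\<close> bounds the moment over the remaining time; \<open>G 0 x\<close> records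
    whether this visit takes place.\<close>
  have *: "F m x \<le> 1 + \<eta> * Z * (\<Sum>t<m. G t x)" if "m \<le> n" for m x
    using that
  proof (induction m arbitrary: x)
    case (Suc m)
    have 1: "avg S (\<lambda>s. F m (f x s)) \<le> 1 + \<eta> * Z * (\<Sum>t<m. G (Suc t) x)"
    proof -
      have "avg S (\<lambda>s. F m (f x s)) \<le> avg S (\<lambda>s. 1 + \<eta> * Z * (\<Sum>t<m. G t (f x s)))"
        using Suc by (intro avg_mono) auto
      also have "\<dots> = 1 + \<eta> * Z * (\<Sum>t<m. G (Suc t) x)"
        by (simp only: avg_add avg_cmult avg_sum G_Suc avg_const[OF S])
      finally show ?thesis .
    qed
    have 2: "avg S (\<lambda>s. F m (f x s)) \<le> Z"
      using avg_mono[of S "\<lambda>s. F m (f x s)" "\<lambda>_. Z"] Z[of m] Suc.prems by (simp add: avg_const[OF S])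
    have "F (Suc m) x = avg S (\<lambda>s. F m (f x s)) + \<eta> * of_bool (x \<in> B) * avg S (\<lambda>s. F m (f x s))"
      by (simp add: F_Suc algebra_simps)
    also have "\<dots> \<le> (1 + \<eta> * Z * (\<Sum>t<m. G (Suc t) x)) + \<eta> * of_bool (x \<in> B) * Z"
      using 1 2 \<eta> by (intro add_mono mult_left_mono) auto
    also have "\<dots> = 1 + \<eta> * Z * (\<Sum>t<Suc m. G t x)"
      by (subst sum.lessThan_Suc_shift) (simp add: G_def algebra_simps)
    finally show ?case .
  qed (simp add: F_def)
  have "F n x \<le> 1 + Z / 2" for x
  proof -
    have "F n x \<le> 1 + \<eta> * Z * C"
      using *[of n x] green[of x] \<eta> Zge unfolding G_def
      by (smt (verit, best) mult_left_mono order_refl mult_nonneg_nonneg)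
    also have "\<dots> \<le> 1 + Z / 2" using mult_right_mono[OF \<eta>(2) Zge] by (simp add: algebra_simps)
    finally show ?thesis .
  qed
  \<comment> \<open>Taking the supremum over \<open>x\<close> gives an inequality for the finite
    number \<open>Z\<close> that forces \<open>Z \<le> 2\<close>.\<close>
  then have "Z \<le> 1 + Z / 2" unfolding Z_def[symmetric] by (subst (1) Z_def) (auto intro!: cSUP_least)
  then show ?thesis using Z[of m x] \<open>m \<le> n\<close> unfolding F_def by linarith
qed

text \<open>Cut the word into at most \<open>k\<close> periods of length at most \<open>n\<close>;
  by the Markov property each costs a factor 2.\<close>

lemma wavg_visits_power_le:
  fixes f :: "'b \<Rightarrow> 'a \<Rightarrow> 'b"
  assumes S: "finite S" "S \<noteq> {}"
    and green: "\<And>x. (\<Sum>t<n. wavg S t (\<lambda>w. of_bool (foldl f x w \<in> B))) \<le> C"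
    and \<eta>: "0 \<le> \<eta>" "\<eta> * C \<le> 1 / 2" and "m \<le> k * n"
  shows "wavg S m (\<lambda>w. (1 + \<eta>) ^ visits f B x w) \<le> 2 ^ k"
  using \<open>m \<le> k * n\<close>
proof (induction k arbitrary: m x)
  case 0
  then show ?case by simp
next
  case (Suc k)
  let ?a = "min m n"
  have m: "m = ?a + (m - ?a)" by simp
  have "wavg S m (\<lambda>w. (1 + \<eta>) ^ visits f B x w)
      = wavg S ?a (\<lambda>u. (1 + \<eta>) ^ visits f B x u *
          wavg S (m - ?a) (\<lambda>v. (1 + \<eta>) ^ visits f B (foldl f x u) v))"
    by (subst m, subst wavg_append) (simp add: visits_append power_add wavg_cmult)
  also have "\<dots> \<le> wavg S ?a (\<lambda>u. 2 ^ k * (1 + \<eta>) ^ visits f B x u)"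
  proof (intro wavg_mono)
    fix u
    have "wavg S (m - ?a) (\<lambda>v. (1 + \<eta>) ^ visits f B (foldl f x u) v) \<le> 2 ^ k"
      using Suc.prems by (intro Suc.IH) auto
    then show "(1 + \<eta>) ^ visits f B x u * wavg S (m - ?a) (\<lambda>v. (1 + \<eta>) ^ visits f B (foldl f x u) v)
        \<le> 2 ^ k * (1 + \<eta>) ^ visits f B x u"
      using \<eta> by (simp add: mult.commute mult_left_mono)
  qed
  also have "\<dots> \<le> 2 ^ k * 2"
    unfolding wavg_cmult using \<eta> by (intro mult_left_mono wavg_visits_power_le_2[OF S green]) auto
  finally show ?case by simp
qed

lemma wavg_visits_tail:
  fixes f :: "'b \<Rightarrow> 'a \<Rightarrow> 'b"
  assumes S: "finite S" "S \<noteq> {}"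
    and green: "\<And>x. (\<Sum>t<n. wavg S t (\<lambda>w. of_bool (foldl f x w \<in> B))) \<le> C"
    and \<eta>: "0 \<le> \<eta>" "\<eta> * C \<le> 1 / 2" and "m \<le> k * n"
  shows "wavg S m (\<lambda>w. of_bool (v \<le> visits f B x w)) \<le> 2 ^ k / (1 + \<eta>) ^ v"
proof -
  have "wavg S m (\<lambda>w. of_bool (v \<le> visits f B x w))
      \<le> wavg S m (\<lambda>w. (1 / (1 + \<eta>) ^ v) * (1 + \<eta>) ^ visits f B x w)"
    using \<eta> by (intro wavg_mono) (auto simp: power_increasing)
  also have "\<dots> \<le> (1 / (1 + \<eta>) ^ v) * 2 ^ k"
    unfolding wavg_cmult using \<eta> assms by (intro mult_left_mono wavg_visits_power_le[OF S green]) auto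
  finally show ?thesis by simp
qed

section \<open>One-dimensional heat kernel modulo \<open>N\<close>\<close>

text \<open>Expectation of \<open>f\<close> at time \<open>n\<close> for simple random walk on
  \<int> started from \<open>z\<close>.\<close>

primrec walk_avg :: "nat \<Rightarrow> (int \<Rightarrow> real) \<Rightarrow> int \<Rightarrow> real" where
  "walk_avg 0 f z = f z"
| "walk_avg (Suc n) f z = (walk_avg n f (z + 1) + walk_avg n f (z - 1)) / 2"

lemma walk_avg_mono: "(\<And>z. f z \<le> g z) \<Longrightarrow> walk_avg n f z \<le> walk_avg n g z"
  by (induction n arbitrary: z) (auto intro!: add_mono)

lemma walk_avg_add: "walk_avg n (\<lambda>z. f z + g z) z = walk_avg n f z + walk_avg n g z"
  by (induction n arbitrary: z) (auto simp: field_simps)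

lemma walk_avg_const: "walk_avg n (\<lambda>_. c) z = c"
  by (induction n arbitrary: z) auto

lemma walk_avg_nonneg: "(\<And>z. 0 \<le> f z) \<Longrightarrow> 0 \<le> walk_avg n f z"
  using walk_avg_mono[of "\<lambda>_. 0" f n z] by (simp add: walk_avg_const)

lemma walk_avg_le_1: "(\<And>z. f z \<le> 1) \<Longrightarrow> walk_avg n f z \<le> 1"
  using walk_avg_mono[of f "\<lambda>_. 1" n z] by (simp add: walk_avg_const)

lemma walk_avg_sum: "finite A \<Longrightarrow> walk_avg n (\<lambda>z. \<Sum>i\<in>A. f i z) z = (\<Sum>i\<in>A. walk_avg n (f i) z)"
  by (induction A rule: finite_induct) (auto simp: walk_avg_add walk_avg_const)

lemma walk_avg_Suc': "walk_avg (Suc n) f z = walk_avg n (\<lambda>z. (f (z + 1) + f (z - 1)) / 2) z"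
  by (induction n arbitrary: z) (simp, simp only: walk_avg.simps)

text \<open>\<open>k\<close> is the number of steps to the left; the two possible first steps give
  the two terms of Pascal's rule.\<close>

lemma walk_avg_eq_binomial:
  "walk_avg n f z = (\<Sum>k\<le>n. real (n choose k) * f (z + int n - 2 * int k)) / 2 ^ n"
proof (induction n arbitrary: z)
  case 0
  then show ?case by simp
next
  case (Suc n)
  let ?g = "\<lambda>k. f (z + int (Suc n) - 2 * int k)"
  have 1: "(\<Sum>k\<le>n. real (n choose k) * f (z + 1 + int n - 2 * int k)) =
      (\<Sum>k\<le>Suc n. real (n choose k) * ?g k)"
    by (simp add: binomial_eq_0 algebra_simps)
  have 2: "(\<Sum>k\<le>n. real (n choose k) * f (z - 1 + int n - 2 * int k)) =
      (\<Sum>k\<le>Suc n. (case k of 0 \<Rightarrow> 0 | Suc k \<Rightarrow> real (n choose k)) * ?g k)"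
    by (subst sum.atMost_Suc_shift) (simp add: algebra_simps)
  have 3: "real (Suc n choose k) = real (n choose k) + (case k of 0 \<Rightarrow> 0 | Suc k \<Rightarrow> real (n choose k))" for k
    by (cases k) auto
  have "(\<Sum>k\<le>Suc n. real (Suc n choose k) * ?g k) =
      (\<Sum>k\<le>n. real (n choose k) * f (z + 1 + int n - 2 * int k)) +
      (\<Sum>k\<le>n. real (n choose k) * f (z - 1 + int n - 2 * int k))"
    unfolding 1 2 3 by (simp add: distrib_right sum.distrib del: sum.atMost_Suc)
  then show ?case by (simp add: Suc field_simps del: sum.atMost_Suc)
qed

section \<open>Size and total variation of the binomial distribution\<close>

text \<open>After squaring, the claim follows by induction: consecutive left sides have ratio
  \<open>4 * (2 * n + 1) * (2 * n + 3) / (n + 1)\<^sup>2\<close>, which is at most 16.\<close>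

lemma central_binomial_upper: "real ((2 * n) choose n) * sqrt (2 * n + 1) \<le> 4 ^ n"
proof -
  have "(real ((2 * n) choose n))\<^sup>2 * (2 * n + 1) \<le> (4 ^ n)\<^sup>2"
  proof (induction n)
    case (Suc n)
    have "Suc n * ((2 * Suc n) choose Suc n) = (2 * Suc n) * ((2 * n + 1) choose n)"
      using Suc_times_binomial_eq[of "2 * n + 1" n] by (simp add: mult.commute)
    moreover have "Suc n * ((2 * n + 1) choose n) = (2 * n + 1) * ((2 * n) choose n)"
      using binomial_absorb_comp[of "2 * n + 1" n] by simp
    ultimately have "Suc n * ((2 * Suc n) choose Suc n) = 2 * ((2 * n + 1) * ((2 * n) choose n))"
      by (simp only: mult.assoc)
    then have "real (Suc n * ((2 * Suc n) choose Suc n)) = real (2 * ((2 * n + 1) * ((2 * n) choose n)))"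
      by (rule arg_cong)
    then have "real (Suc n) * real ((2 * Suc n) choose Suc n) = 2 * (2 * n + 1) * real ((2 * n) choose n)"
      by (simp only: of_nat_mult of_nat_add of_nat_numeral of_nat_1 mult.assoc)
    then have eq: "real ((2 * Suc n) choose Suc n) = 2 * (2 * n + 1) / (n + 1) * real ((2 * n) choose n)"
      by (simp add: field_simps)
    have nz: "1 + (real n * real n + real n * 2) \<noteq> 0"
      "\<not> 1 + (real n * real n + real n * 2) < 0"
      using mult_nonneg_nonneg[of "real n" "real n"] by linarith+
    have "(real ((2 * Suc n) choose Suc n))\<^sup>2 * (2 * Suc n + 1) =
        ((real ((2 * n) choose n))\<^sup>2 * (2 * n + 1)) * (4 * (2 * n + 1) * (2 * n + 3) / (n + 1)\<^sup>2)"
      unfolding eq using nz by (simp add: power2_eq_square divide_simps) (simp add: algebra_simps)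
    also have "\<dots> \<le> (4 ^ n)\<^sup>2 * 16"
    proof (intro mult_mono Suc)
      show "real (4 * (2 * n + 1) * (2 * n + 3)) / real ((n + 1)\<^sup>2) \<le> 16"
        by (subst pos_divide_le_eq) (auto simp: power2_eq_square algebra_simps intro!: add_pos_nonneg)
    qed auto
    finally show ?case by (simp add: power2_eq_square)
  qed simp
  then have "(real ((2 * n) choose n) * sqrt (2 * n + 1))\<^sup>2 \<le> (4 ^ n)\<^sup>2"
    by (simp add: power_mult_distrib)
  then show ?thesis by (rule power2_le_imp_le) simp
qed

text \<open>For \<open>n = 2 * m + 1\<close> the two middle coefficients are equal and add up to the
  central coefficient for \<open>2 * m + 2\<close>.\<close>

lemma binomial_mid_upper: "real (n choose (n div 2)) / 2 ^ n \<le> 1 / sqrt (n + 1)"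
proof (cases "even n")
  case True
  then obtain m where m: "n = 2 * m" by blast
  have "real ((2 * m) choose m) \<le> 4 ^ m / sqrt (2 * m + 1)"
    using central_binomial_upper[of m] by (simp add: field_simps)
  then have "real (n choose (n div 2)) \<le> 2 ^ n / sqrt (n + 1)"
    by (simp add: m power_mult)
  then show ?thesis by (simp add: field_simps)
next
  case False
  then obtain m where m: "n = 2 * m + 1" using oddE by blast
  have "(2 * Suc m) choose Suc m = ((2 * m + 1) choose m) + ((2 * m + 1) choose Suc m)"
    using binomial_Suc_Suc[of "2 * m + 1" m] by simp
  also have "(2 * m + 1) choose Suc m = (2 * m + 1) choose m"
    using binomial_symmetric[of m "2 * m + 1"] by simp
  finally have 1: "real ((2 * Suc m) choose Suc m) = 2 * real (n choose (n div 2))"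
    by (simp add: m)
  have "2 * real (n choose (n div 2)) * sqrt (n + 1) \<le> real ((2 * Suc m) choose Suc m) * sqrt (2 * Suc m + 1)"
    unfolding 1 by (intro mult_left_mono) (auto simp: m)
  also have "\<dots> \<le> 2 * 2 ^ n" using central_binomial_upper[of "Suc m"] by (simp add: m power_mult)
  finally show ?thesis by (simp add: field_simps)
qed

text \<open>The differences telescope on each side of the maximum at \<open>m\<close>, to
  \<open>b m - b 0\<close> before it and \<open>b m - b L\<close> after it.\<close>

lemma sum_abs_diff_unimodal:
  fixes b :: "nat \<Rightarrow> real"
  assumes up: "\<And>l. l < m \<Longrightarrow> b l \<le> b (Suc l)" and down: "\<And>l. m \<le> l \<Longrightarrow> b (Suc l) \<le> b l"
    and nonneg: "\<And>l. 0 \<le> b l"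
  shows "(\<Sum>l<L. \<bar>b l - b (Suc l)\<bar>) \<le> 2 * b m"
proof -
  have 1: "(\<Sum>l<L. \<bar>b l - b (Suc l)\<bar>) = b L - b 0" if "L \<le> m" for L
    using that up by (induction L) (auto simp: Suc_le_eq)
  have 2: "(\<Sum>l<m + L. \<bar>b l - b (Suc l)\<bar>) = 2 * b m - b 0 - b (m + L)" for L
    using down by (induction L) (auto simp: 1)
  show ?thesis
  proof (cases "L \<le> m")
    case True
    then have "b L \<le> b m"
      by (induction rule: inc_induct) (use up in \<open>auto intro: order.trans\<close>)
    then show ?thesis using 1[OF True] nonneg[of 0] nonneg[of m] by linarith
  next
    case False
    then show ?thesis using 2[of "L - m"] nonneg[of 0] nonneg[of L] by simp
  qed
qed

text \<open>Each value at a point of \<open>A\<close> is compared with the average over the next \<open>h\<close> points.\<close>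
lemma sum_separated_le:
  fixes b :: "nat \<Rightarrow> real"
  assumes "finite A" "0 < h" and sep: "\<And>k k'. k \<in> A \<Longrightarrow> k' \<in> A \<Longrightarrow> k < k' \<Longrightarrow> k + h \<le> k'"
    and nonneg: "\<And>l. 0 \<le> b l"
    and total: "\<And>L. (\<Sum>l<L. b l) \<le> P" and var: "\<And>L. (\<Sum>l<L. \<bar>b l - b (Suc l)\<bar>) \<le> V"
  shows "(\<Sum>k\<in>A. b k) \<le> P / h + V"
proof -
  let ?I = "\<lambda>k. {k..<k + h}"
  define L where "L = Max (insert 0 A) + h"
  have sub: "(\<Union>k\<in>A. ?I k) \<subseteq> {..<L}"
  proof
    fix l assume "l \<in> (\<Union>k\<in>A. ?I k)"
    then obtain k where k: "k \<in> A" "l < k + h" by auto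
    have "k \<le> Max (insert 0 A)" using k \<open>finite A\<close> by simp
    with k show "l \<in> {..<L}" by (simp add: L_def)
  qed
  have disj: "\<forall>k\<in>A. \<forall>k'\<in>A. k \<noteq> k' \<longrightarrow> ?I k \<inter> ?I k' = {}"
    using sep by (fastforce simp: neq_iff)
  have sums: "(\<Sum>k\<in>A. \<Sum>l\<in>?I k. g l) \<le> (\<Sum>l<L. g l)" if "\<And>l. 0 \<le> g l" for g :: "nat \<Rightarrow> real"
    using sum.UNION_disjoint[OF \<open>finite A\<close> _ disj, of g] sum_mono2[OF _ sub, of g] that by auto
  have "h * b k \<le> (\<Sum>l\<in>?I k. b l) + h * (\<Sum>l\<in>?I k. \<bar>b l - b (Suc l)\<bar>)" for k
  proof -
    have tele: "b k - b (k + i) \<le> (\<Sum>l\<in>{k..<k + i}. \<bar>b l - b (Suc l)\<bar>)" for i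
      by (induction i) auto
    have "b k \<le> b l + (\<Sum>l\<in>?I k. \<bar>b l - b (Suc l)\<bar>)" if "l \<in> ?I k" for l
    proof -
      have "(\<Sum>l\<in>{k..<l}. \<bar>b l - b (Suc l)\<bar>) \<le> (\<Sum>l\<in>?I k. \<bar>b l - b (Suc l)\<bar>)"
        using that by (intro sum_mono2) auto
      then show ?thesis using tele[of "l - k"] that by simp
    qed
    then have "(\<Sum>l\<in>?I k. b k) \<le> (\<Sum>l\<in>?I k. b l + (\<Sum>l\<in>?I k. \<bar>b l - b (Suc l)\<bar>))"
      by (intro sum_mono) auto
    then show ?thesis by (simp add: sum.distrib)
  qed
  then have "h * (\<Sum>k\<in>A. b k) \<le> (\<Sum>k\<in>A. (\<Sum>l\<in>?I k. b l) + h * (\<Sum>l\<in>?I k. \<bar>b l - b (Suc l)\<bar>))"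
    unfolding sum_distrib_left by (intro sum_mono) auto
  also have "\<dots> = (\<Sum>k\<in>A. (\<Sum>l\<in>?I k. b l)) + h * (\<Sum>k\<in>A. \<Sum>l\<in>?I k. \<bar>b l - b (Suc l)\<bar>)"
    by (simp only: sum.distrib sum_distrib_left)
  also have "\<dots> \<le> P + h * V"
    using sums[of b] sums[of "\<lambda>l. \<bar>b l - b (Suc l)\<bar>"] total[of L] var[of L] nonneg
    by (intro add_mono mult_left_mono) (auto intro: order.trans)
  finally show ?thesis using \<open>0 < h\<close> by (simp add: field_simps)
qed

text \<open>The numbers \<open>k\<close> of left steps that lead to the residue class of
  \<open>a\<close> are far apart, so \<open>sum_separated_le\<close> applies to the binomial
  weights: their mass is 1 and their total variation is at most twice the central weight.\<close>

lemma walk_avg_residue_le: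
  assumes "0 < N"
  shows "walk_avg n (\<lambda>z. of_bool (int N dvd z - a)) z \<le> 2 / N + 2 / sqrt (n + 1)"
proof -
  define b where "b = (\<lambda>k. real (n choose k) / 2 ^ n)"
  define A where "A = {k. k \<le> n \<and> int N dvd z + int n - 2 * int k - a}"
  \<comment> \<open>Replacing a right step by a left step moves the walk by 2, so equal residues
    only force the numbers of left steps to differ by at least \<open>N / 2\<close>;
    \<open>h\<close> is this bound rounded up.\<close>
  define h where "h = (N + 1) div 2"
  have "walk_avg n (\<lambda>z. of_bool (int N dvd z - a)) z = (\<Sum>k\<in>A. b k)"
  proof -
    have "walk_avg n (\<lambda>z. of_bool (int N dvd z - a)) z =
        (\<Sum>k\<le>n. b k * of_bool (int N dvd z + int n - 2 * int k - a))"
      by (simp only: walk_avg_eq_binomial b_def sum_divide_distrib times_divide_eq_left)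
    also have "\<dots> = (\<Sum>k\<in>{..n}. if k \<in> A then b k else 0)"
      by (intro sum.cong) (auto simp: A_def)
    also have "\<dots> = (\<Sum>k\<in>{..n} \<inter> A. b k)"
      by (rule sum.inter_restrict[symmetric]) simp
    also have "{..n} \<inter> A = A" by (auto simp: A_def)
    finally show ?thesis .
  qed
  also have "\<dots> \<le> 1 / h + 2 * b (n div 2)"
  proof (rule sum_separated_le)
    show "finite A" by (simp add: A_def)
    show "0 < h" using assms by (simp add: h_def)
    show "k + h \<le> k'" if "k \<in> A" "k' \<in> A" "k < k'" for k k'
    proof -
      have "int N dvd (z + int n - 2 * int k - a) - (z + int n - 2 * int k' - a)"
        by (rule dvd_diff) (use that in \<open>simp_all add: A_def\<close>)
      then have "int N dvd 2 * (int k' - int k)" by (simp add: algebra_simps)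
      then have "int N \<le> 2 * (int k' - int k)" using that by (intro zdvd_imp_le) auto
      then show ?thesis by (simp add: h_def)
    qed
    show "0 \<le> b l" for l by (simp add: b_def)
    show "(\<Sum>l<L. b l) \<le> 1" for L
    proof -
      have "(\<Sum>l<L. b l) \<le> (\<Sum>l<max L (Suc n). b l)" by (intro sum_mono2) (auto simp: b_def)
      also have "\<dots> = (\<Sum>l\<le>n. b l)"
        by (intro sum.mono_neutral_right) (auto simp: b_def binomial_eq_0)
      also have "\<dots> = real (\<Sum>l\<le>n. n choose l) / 2 ^ n" by (simp add: b_def sum_divide_distrib)
      also have "\<dots> = 1" by (simp add: choose_row_sum)
      finally show ?thesis .
    qed
    show "(\<Sum>l<L. \<bar>b l - b (Suc l)\<bar>) \<le> 2 * b (n div 2)" for L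
    proof (rule sum_abs_diff_unimodal)
      show "b l \<le> b (Suc l)" if "l < n div 2" for l
        using that binomial_mono[of l "Suc l" n] by (simp add: b_def divide_right_mono)
      show "b (Suc l) \<le> b l" if "n div 2 \<le> l" for l
      proof (cases "Suc l \<le> n")
        case True
        then show ?thesis
          using that binomial_antimono[of l "Suc l" n] by (simp add: b_def divide_right_mono)
      qed (simp add: b_def binomial_eq_0)
    qed (simp add: b_def)
  qed
  also have "\<dots> \<le> 2 / N + 2 / sqrt (n + 1)"
  proof (intro add_mono)
    have "real N \<le> 2 * h" by (simp add: h_def)
    then show "1 / real h \<le> 2 / N" using assms by (simp add: field_simps h_def)
    show "2 * b (n div 2) \<le> 2 / sqrt (real (n + 1))"
      using mult_left_mono[OF binomial_mid_upper[of n], of 2] by (simp add: b_def add.commute)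
  qed
  finally show ?thesis by (simp add: add.commute)
qed

section \<open>Blocks hit by a one-dimensional walk at prescribed times\<close>

text \<open>Each list entry is a unit of time: the first component tells whether the current position is
  observed (its block is then removed from \<open>A\<close>), the second whether the walk moves, by a fair \<open>\<plusminus>1\<close>, or rests.\<close>
primrec hit_avg :: "(int \<Rightarrow> 'b set) \<Rightarrow> (int \<Rightarrow> 'b set \<Rightarrow> real) \<Rightarrow> (bool \<times> bool) list \<Rightarrow> int \<Rightarrow> 'b set \<Rightarrow> real" where
  "hit_avg blk g [] z A = g z A"
| "hit_avg blk g (e # l) z A = (let A' = (if fst e then A - blk z else A) in
     if snd e then (hit_avg blk g l (z + 1) A' + hit_avg blk g l (z - 1) A') / 2 else hit_avg blk g l z A')"

definition marks :: "(bool \<times> bool) list \<Rightarrow> nat" where "marks l = length (filter fst l)"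
definition moves :: "(bool \<times> bool) list \<Rightarrow> nat" where "moves l = length (filter snd l)"

lemma marks_simps [simp]: "marks [] = 0" "marks (e # l) = of_bool (fst e) + marks l"
  "marks (l @ l') = marks l + marks l'"
  by (auto simp: marks_def)

lemma moves_simps [simp]: "moves [] = 0" "moves (e # l) = of_bool (snd e) + moves l"
  "moves (l @ l') = moves l + moves l'"
  by (auto simp: moves_def)

lemma hit_avg_append: "hit_avg blk g (l @ l') = hit_avg blk (hit_avg blk g l') l"
proof (induction l)
  case (Cons e l)
  then show ?case by (auto simp: fun_eq_iff Let_def)
qed (simp add: fun_eq_iff)

text \<open>A set reached along \<open>l\<close> is a subset of \<open>A\<close> that has lost at
  most one block per mark, so \<open>g\<close> and \<open>h\<close> need only be compared on such
  sets.\<close>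

lemma hit_avg_mono:
  assumes "\<And>z. finite (blk z) \<and> card (blk z) \<le> 1" "finite A"
    and "\<And>z A'. A' \<subseteq> A \<Longrightarrow> card A \<le> card A' + marks l \<Longrightarrow> g z A' \<le> h z A'"
  shows "hit_avg blk g l z A \<le> hit_avg blk h l z A"
  using assms(2,3)
proof (induction l arbitrary: z A)
  case (Cons e l)
  let ?A' = "if fst e then A - blk z else A"
  have card: "card A \<le> card ?A' + of_bool (fst e)"
    using assms(1)[of z] diff_card_le_card_Diff[of "blk z" A] by auto
  have "hit_avg blk g l z' ?A' \<le> hit_avg blk h l z' ?A'" for z'
  proof (rule Cons.IH)
    show "finite ?A'" using Cons.prems by simp
    show "g z'' A'' \<le> h z'' A''" if "A'' \<subseteq> ?A'" "card ?A' \<le> card A'' + marks l" for z'' A''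
      using that card Cons.prems(1) by (intro Cons.prems(2)) (auto split: if_splits)
  qed
  then show ?case by (auto simp: Let_def intro!: add_mono)
qed auto

lemma hit_avg_affine: "hit_avg blk (\<lambda>z A. a + b * g z A) l z A = a + b * hit_avg blk g l z A"
  by (induction l arbitrary: z A) (auto simp: Let_def field_simps)

lemma hit_avg_unmarked:
  "marks l = 0 \<Longrightarrow> hit_avg blk g l z A = walk_avg (moves l) (\<lambda>z. g z A) z"
  by (induction l arbitrary: z) (auto simp: Let_def)

section \<open>Decrease of the number of surviving blocks\<close>

text \<open>Linearised count of the removals: \<open>A\<close> stays fixed, so repeated hits of a
  block are all counted. The sum can therefore be estimated one observation at a time.\<close>

primrec expected_hits :: "(int \<Rightarrow> 'b set) \<Rightarrow> 'b set \<Rightarrow> (bool \<times> bool) list \<Rightarrow> int \<Rightarrow> real" where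
  "expected_hits blk A [] z = 0"
| "expected_hits blk A (e # l) z = (if fst e then real (card (A \<inter> blk z)) else 0) +
     (if snd e then (expected_hits blk A l (z + 1) + expected_hits blk A l (z - 1)) / 2
      else expected_hits blk A l z)"

lemma expected_hits_mono:
  "finite A \<Longrightarrow> A' \<subseteq> A \<Longrightarrow> expected_hits blk A' l z \<le> expected_hits blk A l z"
proof (induction l arbitrary: z)
  case (Cons e l)
  have "card (A' \<inter> blk z) \<le> card (A \<inter> blk z)" using Cons.prems by (intro card_mono) auto
  then show ?case using Cons by (auto intro!: add_mono divide_right_mono)
qed auto

text \<open>Every removal is counted by \<open>expected_hits\<close>, whose value for the smaller
  set left behind is at most that for \<open>A\<close>.\<close>

lemma hit_avg_card_ge:
  "finite A \<Longrightarrow> real (card A) - expected_hits blk A l z \<le> hit_avg blk (\<lambda>_ A. real (card A)) l z A"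
proof (induction l arbitrary: z A)
  case (Cons e l)
  let ?A' = "if fst e then A - blk z else A"
  let ?c = "if fst e then real (card (A \<inter> blk z)) else 0"
  have "card A = card (A - blk z) + card (A \<inter> blk z)"
    using card_Int_Diff[OF Cons.prems, of "blk z"] by simp
  then have c: "real (card A) = real (card ?A') + ?c" by auto
  have ge: "real (card A) - ?c - expected_hits blk A l z' \<le> hit_avg blk (\<lambda>_ A. real (card A)) l z' ?A'" for z'
  proof -
    have "real (card ?A') - expected_hits blk ?A' l z' \<le> hit_avg blk (\<lambda>_ A. real (card A)) l z' ?A'"
      using Cons.prems by (intro Cons.IH) simp
    moreover have "expected_hits blk ?A' l z' \<le> expected_hits blk A l z'"
      using Cons.prems by (intro expected_hits_mono) auto
    ultimately show ?thesis using c by linarith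
  qed
  show ?case using ge[of z] ge[of "z + 1"] ge[of "z - 1"]
    by (cases "fst e"; cases "snd e") (simp_all add: Let_def field_simps)
qed auto

text \<open>Moves inside \<open>l\<close> only add to the \<open>n \<ge> nmin\<close> moves already
  made, so each of the \<open>marks l\<close> observations contributes at most
  \<open>q\<close>.\<close>

lemma walk_avg_expected_hits_le:
  fixes q :: real
  assumes q: "\<And>n z. nmin \<le> n \<Longrightarrow> walk_avg n (\<lambda>z. real (card (A \<inter> blk z))) z \<le> q"
  shows "nmin \<le> n \<Longrightarrow> walk_avg n (expected_hits blk A l) z \<le> marks l * q"
proof (induction l arbitrary: n)
  case Nil
  then show ?case by (simp add: walk_avg_const)
next
  case (Cons e l)
  have eq: "expected_hits blk A (e # l) = (\<lambda>z. (if fst e then real (card (A \<inter> blk z)) else 0) +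
     (if snd e then (expected_hits blk A l (z + 1) + expected_hits blk A l (z - 1)) / 2
      else expected_hits blk A l z))" by (simp add: fun_eq_iff)
  have 1: "walk_avg n (\<lambda>z. if fst e then real (card (A \<inter> blk z)) else 0) z \<le> of_bool (fst e) * q"
    using q[of n z] Cons.prems by (auto simp: walk_avg_const)
  have "walk_avg n (\<lambda>z. if snd e then (expected_hits blk A l (z + 1) + expected_hits blk A l (z - 1)) / 2
      else expected_hits blk A l z) z = walk_avg (n + of_bool (snd e)) (expected_hits blk A l) z"
    by (cases "snd e") (simp_all add: walk_avg_Suc' del: walk_avg.simps)
  also have "\<dots> \<le> marks l * q" using Cons.prems by (intro Cons.IH) simp
  finally show ?case unfolding eq walk_avg_add using 1 by (simp add: distrib_right)
qed

lemma exp_neg_linear_le: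
  fixes x :: real
  assumes "0 \<le> x" "x \<le> 1 / 2" shows "exp (- 2 * x) \<le> 1 - x"
proof -
  have "1 \<le> (1 - x) * (1 + 2 * x)"
    using mult_nonneg_nonneg[of x "1 - 2 * x"] assms by (simp add: algebra_simps)
  also have "\<dots> \<le> (1 - x) * exp (2 * x)"
    using assms exp_ge_add_one_self[of "2 * x"] by (intro mult_left_mono) auto
  finally show ?thesis by (simp add: exp_minus field_simps)
qed

text \<open>One cluster of visits, entered after enough moves for the position to be equidistributed.\<close>
lemma hit_avg_cluster_le:
  fixes p \<theta> :: real
  assumes blk: "\<And>z. finite (blk z) \<and> card (blk z) \<le> 1" and A: "finite A"
    and q: "\<And>n z. nmin \<le> n \<Longrightarrow> walk_avg n (\<lambda>z. real (card (A \<inter> blk z))) z \<le> p * card A"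
    and gap: "marks gap = 0" "nmin \<le> moves gap"
    and \<theta>: "0 \<le> \<theta>" "\<theta> * marks l \<le> 1" and p: "0 \<le> p" "4 * p * marks l \<le> 1"
  shows "hit_avg blk (\<lambda>_ A. exp (- \<theta> * card A)) (gap @ l) z A \<le> exp (- (\<theta> * exp (- 4 * p * marks l)) * card A)"
proof -
  let ?E = "exp (- \<theta> * card A)"
  \<comment> \<open>At most \<open>marks l\<close> blocks disappear, so \<open>\<theta>\<close>
    times the loss lies between 0 and 1, where \<open>exp y \<le> 1 + 2 * y\<close>. After this
    affine bound only the expected loss matters.\<close>
  have "hit_avg blk (\<lambda>_ A. exp (- \<theta> * card A)) l z A \<le> ?E * (1 + 2 * \<theta> * expected_hits blk A l z)" for z
  proof -
    have "hit_avg blk (\<lambda>_ A. exp (- \<theta> * card A)) l z A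
        \<le> hit_avg blk (\<lambda>_ A'. ?E * (1 + 2 * \<theta> * card A) + (- ?E * 2 * \<theta>) * card A') l z A"
    proof (rule hit_avg_mono[OF blk A])
      fix A' assume A': "A' \<subseteq> A" "card A \<le> card A' + marks l"
      define y where "y = \<theta> * (real (card A) - card A')"
      have "0 \<le> y" using A' A \<theta> by (auto simp: y_def card_mono intro!: mult_nonneg_nonneg)
      have "y \<le> \<theta> * marks l" unfolding y_def using A' \<theta> by (intro mult_left_mono) auto
      then have "y \<le> 1" using \<theta> by simp
      have "exp y \<le> 1 + y + y\<^sup>2" using exp_bound \<open>0 \<le> y\<close> \<open>y \<le> 1\<close> by blast
      also have "\<dots> \<le> 1 + 2 * y"
        using mult_left_mono[OF \<open>y \<le> 1\<close> \<open>0 \<le> y\<close>] by (simp add: power2_eq_square)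
      finally have "exp y \<le> 1 + 2 * y" .
      then have "?E * exp y \<le> ?E * (1 + 2 * y)" by simp
      moreover have "exp (- \<theta> * card A') = ?E * exp y"
        by (simp add: y_def exp_add[symmetric] algebra_simps)
      ultimately show "exp (- \<theta> * card A') \<le> ?E * (1 + 2 * \<theta> * card A) + (- ?E * 2 * \<theta>) * card A'"
        by (simp add: y_def algebra_simps)
    qed
    also have "\<dots> = ?E * (1 + 2 * \<theta> * card A) + (- ?E * 2 * \<theta>) * hit_avg blk (\<lambda>_ A. real (card A)) l z A"
      by (rule hit_avg_affine)
    also have "\<dots> \<le> ?E * (1 + 2 * \<theta> * card A) + (- ?E * 2 * \<theta>) * (card A - expected_hits blk A l z)"
      using hit_avg_card_ge[OF A] \<theta> by (intro add_left_mono mult_left_mono_neg) auto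
    finally show ?thesis by (simp add: algebra_simps)
  qed
  then have "hit_avg blk (\<lambda>_ A. exp (- \<theta> * card A)) (gap @ l) z A
      \<le> walk_avg (moves gap) (\<lambda>z. ?E + ?E * 2 * \<theta> * expected_hits blk A l z) z"
    unfolding hit_avg_append hit_avg_unmarked[OF gap(1)] by (intro walk_avg_mono) (simp add: algebra_simps)
  also have "\<dots> = ?E + ?E * 2 * \<theta> * walk_avg (moves gap) (expected_hits blk A l) z"
  proof -
    have "walk_avg n (\<lambda>z. a + b * f z) z = a + b * walk_avg n f z" for n a b f z
      by (induction n arbitrary: z) (auto simp: field_simps)
    then show ?thesis .
  qed
  also have "\<dots> \<le> ?E + ?E * 2 * \<theta> * (marks l * (p * card A))"
    using walk_avg_expected_hits_le[of nmin A blk "p * card A", OF q gap(2)] \<theta>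
    by (intro add_left_mono mult_left_mono) auto
  also have "\<dots> = ?E * (1 + \<theta> * card A * (2 * p * marks l))" by (simp add: algebra_simps)
  also have "\<dots> \<le> ?E * exp (\<theta> * card A * (2 * p * marks l))"
    by (intro mult_left_mono exp_ge_add_one_self) auto
  also have "\<dots> = exp (- (\<theta> * card A) * (1 - 2 * p * marks l))"
    by (simp add: exp_add[symmetric] algebra_simps)
  \<comment> \<open>Replacing \<open>1 - x\<close> by \<open>exp (- 2 * x)\<close>, with
    \<open>x = 2 * p * marks l \<le> 1 / 2\<close>, makes the loss factors of successive clusters
    multiply.\<close>
  also have "\<dots> \<le> exp (- (\<theta> * card A) * exp (- 2 * (2 * p * marks l)))"
    using p \<theta> by (subst exp_le_cancel_iff, intro mult_left_mono_neg exp_neg_linear_le) auto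
  also have "\<dots> = exp (- (\<theta> * exp (- 4 * p * marks l)) * card A)" by (simp add: algebra_simps)
  finally show ?thesis .
qed

lemma marks_concat_ge_length: "(\<And>w. w \<in> set ws \<Longrightarrow> 0 < marks w) \<Longrightarrow> length ws \<le> marks (concat ws)"
proof (induction ws)
  case (Cons w ws)
  have "0 < marks w" "length ws \<le> marks (concat ws)" using Cons by auto
  then show ?case by simp
qed simp

text \<open>Induction over the clusters, backwards in time. After the last one, the indicator of
  \<open>A = {}\<close> is at most \<open>exp (- \<theta> * card A)\<close> with
  \<open>\<theta> = 1 / s\<close>; going back over a cluster with \<open>v\<close> visits multiplies
  \<open>\<theta>\<close> by \<open>exp (- 4 * p * v)\<close>. The entries of \<open>ws\<close> are
  periods with at least \<open>nmin\<close> moves, and a cluster is a maximal run of periods with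
  visits, so that a period without visits precedes it.\<close>

lemma hit_avg_all_hit_le:
  fixes p :: real
  assumes blk: "\<And>z. finite (blk z) \<and> card (blk z) \<le> 1"
    and U: "finite U"
    and q: "\<And>A n z. A \<subseteq> U \<Longrightarrow> nmin \<le> n \<Longrightarrow> walk_avg n (\<lambda>z. real (card (A \<inter> blk z))) z \<le> p * card A"
    and p: "0 \<le> p" "4 * p * s \<le> 1" and s: "0 < s"
  shows "\<lbrakk>A \<subseteq> U; ws = [] \<or> marks (hd ws) = 0; \<And>w. w \<in> set ws \<Longrightarrow> nmin \<le> moves w;
      \<And>i. marks (concat (take s (drop i ws))) < s\<rbrakk> \<Longrightarrow>
    hit_avg blk (\<lambda>_ A. of_bool (A = {})) (concat ws) z A \<le> exp (- (exp (- 4 * p * marks (concat ws)) / s) * card A)"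
proof (induction "length ws" arbitrary: ws z A rule: less_induct)
  case less
  have finA: "finite B" if "B \<subseteq> A" for B using that less.prems(1) U by (meson finite_subset)
  show ?case
  proof (cases ws)
    case Nil
    then show ?thesis by simp
  next
    case (Cons e rest)
    define cl where "cl = takeWhile (\<lambda>w. 0 < marks w) rest"
    define ws' where "ws' = dropWhile (\<lambda>w. 0 < marks w) rest"
    have ws: "ws = e # cl @ ws'" by (simp add: Cons cl_def ws'_def)
    \<comment> \<open>Each period of a cluster contains a visit, while \<open>s\<close> consecutive
      periods contain fewer than \<open>s\<close> visits; hence the cluster fits into one such
      window.\<close>
    have cl_len: "length cl < s"
    proof (rule ccontr)
      assume *: "\<not> length cl < s"
      then have "take s (drop 1 ws) = take s cl" by (simp add: ws)
      moreover have "length (take s cl) \<le> marks (concat (take s cl))"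
        by (intro marks_concat_ge_length) (auto simp: cl_def dest!: in_set_takeD set_takeWhileD)
      ultimately show False using less.prems(4)[of 1] * by simp
    qed
    have cl_marks: "marks (concat cl) < s"
    proof -
      have "take s (drop 1 ws) = cl @ take (s - length cl) ws'" using cl_len by (simp add: ws)
      then show ?thesis using less.prems(4)[of 1] by simp
    qed
    define \<theta> where "\<theta> = exp (- 4 * p * marks (concat ws')) / s"
    have \<theta>: "0 \<le> \<theta>" "\<theta> * s \<le> 1" using s p by (auto simp: \<theta>_def)
    have IH: "hit_avg blk (\<lambda>_ A. of_bool (A = {})) (concat ws') z B \<le> exp (- \<theta> * card B)" if "B \<subseteq> A" for z B
      unfolding \<theta>_def
    proof (rule less.hyps)
      show "length ws' < length ws" by (simp add: ws)
      show "B \<subseteq> U" using that less.prems by simp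
      show "ws' = [] \<or> marks (hd ws') = 0"
        using hd_dropWhile[of "\<lambda>w. 0 < marks w" rest] unfolding ws'_def by blast
      show "nmin \<le> moves w" if "w \<in> set ws'" for w using that less.prems(3) by (simp add: ws)
      show "marks (concat (take s (drop i ws'))) < s" for i
        using less.prems(4)[of "Suc (length cl + i)"] by (simp add: ws)
    qed
    have "\<theta> * marks (concat cl) \<le> \<theta> * s" using \<theta> cl_marks by (intro mult_left_mono) auto
    moreover have "4 * p * marks (concat cl) \<le> 4 * p * s" using p cl_marks by (intro mult_left_mono) auto
    ultimately have *: "\<theta> * marks (concat cl) \<le> 1" "4 * p * marks (concat cl) \<le> 1" using \<theta> p by auto
    have "hit_avg blk (\<lambda>_ A. of_bool (A = {})) (concat ws) z A
        = hit_avg blk (hit_avg blk (\<lambda>_ A. of_bool (A = {})) (concat ws')) (e @ concat cl) z A"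
      by (simp add: ws hit_avg_append)
    also have "\<dots> \<le> hit_avg blk (\<lambda>_ A. exp (- \<theta> * card A)) (e @ concat cl) z A"
      using IH by (intro hit_avg_mono blk finA) auto
    also have "\<dots> \<le> exp (- (\<theta> * exp (- 4 * p * marks (concat cl))) * card A)"
      using less.prems * \<theta> p
      by (intro hit_avg_cluster_le[where nmin = nmin] blk finA q) (auto simp: ws)
    also have "\<theta> * exp (- 4 * p * marks (concat cl)) = exp (- 4 * p * marks (concat ws)) / s"
    proof -
      have "marks e = 0" using less.prems(2) by (simp add: ws)
      then have "marks (concat ws) = marks (concat ws') + marks (concat cl)" by (simp add: ws)
      then show ?thesis by (simp add: \<theta>_def exp_add[symmetric] algebra_simps)
    qed
    finally show ?thesis .
  qed
qed

section \<open>Green function of a line in the torus\<close>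

lemma unit_steps_eq: "unit_steps d = (\<lambda>(c, j) i. c * unit_vec j i) ` ({1, -1} \<times> {1..d})"
proof (intro equalityI subsetI)
  fix s assume "s \<in> unit_steps d"
  then obtain c j where "c \<in> {1, -1}" "j \<in> {1..d}" "s = (\<lambda>i. c * unit_vec j i)"
    unfolding unit_steps_def by blast
  then show "s \<in> (\<lambda>(c, j) i. c * unit_vec j i) ` ({1, -1} \<times> {1..d})"
    by (intro image_eqI[of _ _ "(c, j)"]) auto
next
  fix s :: "nat \<Rightarrow> int" assume "s \<in> (\<lambda>(c, j) i. c * unit_vec j i) ` ({1, -1} \<times> {1..d})"
  then obtain p where p: "p \<in> {1, -1} \<times> {1..d}" "s = (\<lambda>(c, j) i. c * unit_vec j i) p" by blast
  obtain c j where "p = (c, j)" by fastforce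
  with p have "c \<in> {1, -1}" "j \<in> {1..d}" "s = (\<lambda>i. c * unit_vec j i)"
    by (auto simp del: insert_iff)
  then show "s \<in> unit_steps d" unfolding unit_steps_def by blast
qed

lemma inj_on_unit_steps: "inj_on (\<lambda>(c, j) i. c * unit_vec j i) ({1, -1} \<times> A)"
proof (rule inj_onI, clarify)
  fix c c' j j' assume c: "c \<in> {1, -1}" "c' \<in> {1, -1 :: int}"
    and eq: "(\<lambda>i. c * unit_vec j i) = (\<lambda>i. c' * unit_vec j' i)"
  from fun_cong[OF eq, of j] fun_cong[OF eq, of j'] c show "c = c' \<and> j = j'"
    by (auto simp: unit_vec_def split: if_splits)
qed

lemma sum_unit_steps:
  "(\<Sum>s\<in>unit_steps d. g s) = (\<Sum>j\<in>{1..d}. g (unit_vec j) + g (\<lambda>i. - unit_vec j i))"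
proof -
  have "(\<Sum>s\<in>unit_steps d. g s) = (\<Sum>c\<in>{1, -1}. \<Sum>j\<in>{1..d}. g (\<lambda>i. c * unit_vec j i))"
    unfolding unit_steps_eq by (subst sum.reindex[OF inj_on_unit_steps]) (simp add: sum.cartesian_product split_def)
  then show ?thesis by (simp add: sum.distrib)
qed

lemma finite_unit_steps [simp]: "finite (unit_steps d)"
  by (simp add: unit_steps_eq)

lemma card_unit_steps: "card (unit_steps d) = 2 * d"
  unfolding unit_steps_eq by (subst card_image[OF inj_on_unit_steps]) simp

lemma unit_steps_nonempty: "0 < d \<Longrightarrow> unit_steps d \<noteq> {}"
  using card_unit_steps[of d] by auto

lemma unit_stepsE:
  assumes "s \<in> unit_steps d"
  obtains j where "j \<in> {1..d}" "s = unit_vec j" | j where "j \<in> {1..d}" "s = (\<lambda>i. - unit_vec j i)"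
  using assms unfolding unit_steps_def by auto

lemma uminus_unit_steps:
  assumes "s \<in> unit_steps d" shows "(\<lambda>i. - s i) \<in> unit_steps d"
proof -
  obtain c j where cj: "c \<in> {1, -1}" "j \<in> {1..d}" "s = (\<lambda>i. c * unit_vec j i)"
    using assms unfolding unit_steps_def by blast
  then have "- c \<in> {1, -1}" "(\<lambda>i. - s i) = (\<lambda>i. (- c) * unit_vec j i)" by auto
  then show ?thesis using cj(2) unfolding unit_steps_def by blast
qed

text \<open>For unit steps this flips coordinate \<open>j\<close> alone: a step with
  \<open>s j \<noteq> 0\<close> has no other nonzero coordinate.\<close>

definition reflect :: "nat \<Rightarrow> (nat \<Rightarrow> int) \<Rightarrow> (nat \<Rightarrow> int)" where
  "reflect j s = (if s j \<noteq> 0 then \<lambda>i. - s i else s)"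

lemma bij_betw_involution: "(\<And>s. s \<in> S \<Longrightarrow> h s \<in> S) \<Longrightarrow> (\<And>s. s \<in> S \<Longrightarrow> h (h s) = s) \<Longrightarrow> bij_betw h S S"
  by (rule bij_betw_byWitness[where f' = h]) auto

lemma avg_uminus: "avg (unit_steps d) (\<lambda>s. f (\<lambda>i. - s i)) = avg (unit_steps d) f"
  by (rule avg_bij, rule bij_betw_involution) (auto intro: uminus_unit_steps)

lemma avg_reflect: "avg (unit_steps d) (\<lambda>s. f (reflect j s)) = avg (unit_steps d) f"
  by (rule avg_bij, rule bij_betw_involution) (auto simp: reflect_def intro: uminus_unit_steps)

section \<open>Coordinates of the walk given their numbers of steps\<close>

text \<open>The walk is followed in Z^d without reduction; the torus enters through congruences
  modulo \<open>N\<close>.\<close>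

definition vadd :: "(nat \<Rightarrow> int) \<Rightarrow> (nat \<Rightarrow> int) \<Rightarrow> (nat \<Rightarrow> int)" where
  "vadd x s = (\<lambda>i. x i + s i)"

definition step_count :: "nat \<Rightarrow> (nat \<Rightarrow> int) list \<Rightarrow> nat" where
  "step_count i w = length (filter (\<lambda>s. s i \<noteq> 0) w)"

text \<open>A unit step changes a single coordinate, so averaging over \<open>s\<close> and
  \<open>- s\<close> averages one factor of the product, or none if that coordinate lies outside
  \<open>I\<close>.\<close>

lemma prod_step_average:
  fixes F :: "nat \<Rightarrow> int \<Rightarrow> real"
  assumes "finite I" and s: "s \<in> unit_steps d"
  shows "((\<Prod>i\<in>I. F i (x i + s i)) + (\<Prod>i\<in>I. F i (x i - s i))) / 2 =
    (\<Prod>i\<in>I. if s i \<noteq> 0 then (F i (x i + 1) + F i (x i - 1)) / 2 else F i (x i))"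
proof -
  obtain j where j: "s = unit_vec j \<or> s = (\<lambda>i. - unit_vec j i)" using s by (auto elim: unit_stepsE)
  have off: "s i = 0" if "i \<noteq> j" for i using j that by (auto simp: unit_vec_def)
  have on: "s j = 1 \<or> s j = -1" using j by (auto simp: unit_vec_def)
  show ?thesis
  proof (cases "j \<in> I")
    case True
    have "(\<Prod>i\<in>I. F i (x i + s i)) = F j (x j + s j) * (\<Prod>i\<in>I - {j}. F i (x i))"
      using off by (subst prod.remove[OF \<open>finite I\<close> True]) (auto intro!: prod.cong)
    moreover have "(\<Prod>i\<in>I. F i (x i - s i)) = F j (x j - s j) * (\<Prod>i\<in>I - {j}. F i (x i))"
      using off by (subst prod.remove[OF \<open>finite I\<close> True]) (auto intro!: prod.cong)
    moreover have "(\<Prod>i\<in>I. if s i \<noteq> 0 then (F i (x i + 1) + F i (x i - 1)) / 2 else F i (x i))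
        = (F j (x j + 1) + F j (x j - 1)) / 2 * (\<Prod>i\<in>I - {j}. F i (x i))"
      using off on by (subst prod.remove[OF \<open>finite I\<close> True]) (auto intro!: prod.cong)
    ultimately show ?thesis using on by (auto simp: field_simps)
  next
    case False
    then have "s i = 0" if "i \<in> I" for i using that by (cases "i = j") (auto simp: off)
    then show ?thesis by (auto simp: field_simps cong: prod.cong)
  qed
qed

text \<open>Given which coordinate moves at each time, the coordinates are independent simple random
  walks; this follows step by step from the symmetry between \<open>s\<close> and
  \<open>- s\<close>.\<close>

lemma wavg_prod_coordinates:
  fixes f :: "nat \<Rightarrow> int \<Rightarrow> real"
  assumes "finite I"
  shows "wavg (unit_steps d) t (\<lambda>w. \<Prod>i\<in>I. f i (foldl vadd x w i)) =
    wavg (unit_steps d) t (\<lambda>w. \<Prod>i\<in>I. walk_avg (step_count i w) (f i) (x i))"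
proof (induction t arbitrary: x)
  case 0
  then show ?case by (simp add: step_count_def)
next
  case (Suc t)
  let ?S = "unit_steps d"
  define h where "h = (\<lambda>s. wavg ?S t (\<lambda>w. \<Prod>i\<in>I. walk_avg (step_count i w) (f i) (x i + s i)))"
  have "wavg ?S (Suc t) (\<lambda>w. \<Prod>i\<in>I. f i (foldl vadd x w i)) = avg ?S h"
    unfolding wavg.simps(2) foldl.simps Suc.IH h_def by (simp add: vadd_def)
  also have "\<dots> = avg ?S (\<lambda>s. 1 / 2 * (h s + h (\<lambda>i. - s i)))"
    by (simp only: avg_cmult avg_add avg_uminus) simp
  also have "\<dots> = avg ?S (\<lambda>s. wavg ?S t (\<lambda>w. \<Prod>i\<in>I. walk_avg (step_count i (s # w)) (f i) (x i)))"
  proof (rule avg_cong)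
    fix s assume s: "s \<in> ?S"
    have "1 / 2 * (h s + h (\<lambda>i. - s i)) = wavg ?S t (\<lambda>w. 1 / 2 *
        ((\<Prod>i\<in>I. walk_avg (step_count i w) (f i) (x i + s i)) + (\<Prod>i\<in>I. walk_avg (step_count i w) (f i) (x i - s i))))"
      unfolding h_def by (simp only: wavg_cmult wavg_add) simp
    also have "\<dots> = wavg ?S t (\<lambda>w. \<Prod>i\<in>I. walk_avg (step_count i (s # w)) (f i) (x i))"
    proof (rule wavg_cong)
      fix w
      show "1 / 2 * ((\<Prod>i\<in>I. walk_avg (step_count i w) (f i) (x i + s i)) + (\<Prod>i\<in>I. walk_avg (step_count i w) (f i) (x i - s i)))
          = (\<Prod>i\<in>I. walk_avg (step_count i (s # w)) (f i) (x i))"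
        using prod_step_average[OF assms s, of "\<lambda>i. walk_avg (step_count i w) (f i)" x]
        by (auto simp: step_count_def intro!: prod.cong)
    qed
    finally show "1 / 2 * (h s + h (\<lambda>i. - s i)) = \<dots>" .
  qed
  finally show ?case by simp
qed

text \<open>Chernoff bound with weight 1/2 for each step along direction \<open>i\<close>: a letter
  has mean weight \<open>1 - 1 / (2 * d)\<close>, and the threshold, a quarter of the mean
  \<open>t / d\<close>, costs only \<open>2 powr (t / (4 * d))\<close>.\<close>

lemma step_count_tail:
  assumes i: "i \<in> {1..d}"
  shows "wavg (unit_steps d) t (\<lambda>w. of_bool (4 * d * step_count i w < t)) \<le> exp (- real t / (4 * d))"
proof -
  let ?S = "unit_steps d"
  let ?h = "\<lambda>s :: nat \<Rightarrow> int. if s i \<noteq> 0 then 1 / 2 else 1 :: real"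
  have d: "0 < d" using i by simp
  have "(\<Sum>s\<in>?S. ?h s) = (\<Sum>j\<in>{1..d}. 2 - (if j = i then 1 else 0))"
    unfolding sum_unit_steps by (intro sum.cong) (auto simp: unit_vec_def)
  also have "\<dots> = 2 * d - 1" using i by (simp add: sum_subtractf)
  finally have avg: "avg ?S ?h = 1 - 1 / (2 * d)"
    using d by (simp add: avg_def card_unit_steps field_simps)
  have prod: "prod_list (map ?h w) = (1 / 2) ^ step_count i w" for w
    by (induction w) (auto simp: step_count_def)
  have "wavg ?S t (\<lambda>w. of_bool (4 * d * step_count i w < t))
      \<le> wavg ?S t (\<lambda>w. exp (t * ln 2 / (4 * d)) * prod_list (map ?h w))"
  proof (intro wavg_mono)
    fix w
    show "of_bool (4 * d * step_count i w < t) \<le> exp (t * ln 2 / (4 * d)) * prod_list (map ?h w)"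
    proof (cases "4 * d * step_count i w < t")
      case True
      then have "4 * real d * step_count i w \<le> t"
        by (metis less_imp_le of_nat_le_iff of_nat_mult of_nat_numeral)
      then have "step_count i w * ln 2 \<le> t / (4 * d) * ln 2"
        using d by (intro mult_right_mono) (auto simp: field_simps)
      then have "exp (step_count i w * ln 2) \<le> exp (t * ln 2 / (4 * d))" by simp
      also have "exp (step_count i w * ln 2) = 2 ^ step_count i w"
        by (metis exp_ln exp_of_nat_mult zero_less_numeral)
      finally show ?thesis using True unfolding prod by (simp add: field_simps)
    next
      case False
      then show ?thesis by (simp add: prod)
    qed
  qed
  also have "\<dots> = exp (t * ln 2 / (4 * d)) * (1 - 1 / (2 * d)) ^ t"
    by (simp only: wavg_cmult wavg_prod_list avg)
  also have "\<dots> \<le> exp (t / (4 * d)) * exp (- 1 / (2 * d)) ^ t"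
  proof (intro mult_mono power_mono)
    show "exp (t * ln 2 / (4 * d)) \<le> exp (t / (4 * d))"
      using ln_2_less_1 d by (auto intro!: divide_right_mono mult_left_le)
    show "1 - 1 / real (2 * d) \<le> exp (- 1 / real (2 * d))"
      using exp_ge_add_one_self[of "- 1 / real (2 * d)"] by simp
  qed (use d in \<open>auto simp: field_simps\<close>)
  also have "\<dots> = exp (- real t / (4 * d))"
    using d by (simp add: exp_of_nat_mult[symmetric] exp_add[symmetric] field_simps)
  finally show ?thesis .
qed

section \<open>Expected time spent on a line\<close>

text \<open>The line through \<open>y\<close> in direction \<open>e\<^sub>j\<close>, lifted from the
  torus to Z^d.\<close>

definition torus_line :: "nat \<Rightarrow> nat \<Rightarrow> (nat \<Rightarrow> int) \<Rightarrow> nat \<Rightarrow> (nat \<Rightarrow> int) set" where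
  "torus_line d N y j = {z. \<forall>i\<in>{1..d} - {j}. int N dvd z i - y i}"

text \<open>Either some transverse coordinate has made fewer than \<open>t / (4 * d)\<close> steps,
  which \<open>step_count_tail\<close> makes unlikely, or each of the \<open>d - 1\<close>
  transverse coordinates is in its residue class with probability at most \<open>?\<kappa>\<close>,
  and these probabilities multiply.\<close>

lemma wavg_torus_line_le:
  assumes N: "0 < N" and j: "j \<in> {1..d}"
  shows "wavg (unit_steps d) t (\<lambda>w. of_bool (foldl vadd x w \<in> torus_line d N y j))
    \<le> d * exp (- real t / (4 * d)) + (2 / N + 2 / sqrt (real t / (4 * d) + 1)) ^ (d - 1)"
proof -
  let ?S = "unit_steps d" and ?I = "{1..d} - {j}"
  let ?f = "\<lambda>i z. of_bool (int N dvd z - y i) :: real"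
  let ?\<kappa> = "2 / real N + 2 / sqrt (real t / (4 * d) + 1)"
  have S: "finite ?S" "?S \<noteq> {}" using j unit_steps_nonempty[of d] by auto
  have d: "0 < d" using j by simp
  have "wavg ?S t (\<lambda>w. of_bool (foldl vadd x w \<in> torus_line d N y j))
      = wavg ?S t (\<lambda>w. \<Prod>i\<in>?I. ?f i (foldl vadd x w i))"
    by (intro wavg_cong) (auto simp: torus_line_def)
  also have "\<dots> = wavg ?S t (\<lambda>w. \<Prod>i\<in>?I. walk_avg (step_count i w) (?f i) (x i))"
    by (rule wavg_prod_coordinates) simp
  also have "\<dots> \<le> wavg ?S t (\<lambda>w. (\<Sum>i\<in>?I. of_bool (4 * d * step_count i w < t)) + ?\<kappa> ^ (d - 1))"
  proof (intro wavg_mono)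
    fix w
    show "(\<Prod>i\<in>?I. walk_avg (step_count i w) (?f i) (x i))
        \<le> (\<Sum>i\<in>?I. of_bool (4 * d * step_count i w < t)) + ?\<kappa> ^ (d - 1)"
    proof (cases "\<exists>i\<in>?I. 4 * d * step_count i w < t")
      case True
      then obtain i where i: "i \<in> ?I" "4 * d * step_count i w < t" by blast
      have "(\<Prod>i\<in>?I. walk_avg (step_count i w) (?f i) (x i)) \<le> 1"
        by (intro prod_le_1) (auto intro: walk_avg_nonneg walk_avg_le_1)
      also have "1 \<le> (\<Sum>i\<in>?I. of_bool (4 * d * step_count i w < t) :: real)"
        using member_le_sum[of i ?I "\<lambda>i. of_bool (4 * d * step_count i w < t) :: real"] i by auto
      finally show ?thesis by (simp add: add_increasing2)
    next
      case False
      have "(\<Prod>i\<in>?I. walk_avg (step_count i w) (?f i) (x i)) \<le> (\<Prod>i\<in>?I. ?\<kappa>)"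
      proof (intro prod_mono conjI)
        fix i assume i: "i \<in> ?I"
        show "0 \<le> walk_avg (step_count i w) (?f i) (x i)" by (auto intro: walk_avg_nonneg)
        have "\<not> 4 * d * step_count i w < t" using False i by blast
        then have "real t \<le> real (4 * d * step_count i w)" by (simp only: of_nat_le_iff not_less)
        then have "real t / (4 * d) + 1 \<le> real (step_count i w + 1)" using d by (simp add: field_simps)
        then have "2 / sqrt (real (step_count i w + 1)) \<le> 2 / sqrt (real t / (4 * d) + 1)"
          using d by (intro divide_left_mono) (auto intro!: mult_pos_pos add_nonneg_pos)
        then show "walk_avg (step_count i w) (?f i) (x i) \<le> ?\<kappa>"
          using walk_avg_residue_le[OF N, of "step_count i w" "y i" "x i"] by (simp add: add.commute)
      qed
      also have "\<dots> = ?\<kappa> ^ (d - 1)" using j by simp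
      finally show ?thesis by (simp add: add_increasing sum_nonneg)
    qed
  qed
  also have "\<dots> = (\<Sum>i\<in>?I. wavg ?S t (\<lambda>w. of_bool (4 * d * step_count i w < t))) + ?\<kappa> ^ (d - 1)"
    by (subst wavg_add, subst wavg_sum) (simp_all only: wavg_const[OF S] finite_Diff finite_atLeastAtMost)
  also have "\<dots> \<le> (\<Sum>i\<in>?I. exp (- real t / (4 * d))) + ?\<kappa> ^ (d - 1)"
    by (intro add_right_mono sum_mono step_count_tail) auto
  also have "\<dots> \<le> d * exp (- real t / (4 * d)) + ?\<kappa> ^ (d - 1)"
    using j by (simp add: mult_right_mono)
  finally show ?thesis by simp
qed

text \<open>The walk transverse to a line lives in dimension at least three: this is where \<open>d \<ge> 4\<close> enters.\<close>
lemma torus_line_green_bounded: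
  assumes d: "4 \<le> d"
  shows "\<exists>C>0. \<forall>N>0. \<forall>j\<in>{1..d}. \<forall>x y. (\<Sum>t<N ^ (d - 1).
    wavg (unit_steps d) t (\<lambda>w. of_bool (foldl vadd x w \<in> torus_line d N y j))) \<le> C"
proof -
  define r where "r = exp (- 1 / (4 * real d))"
  have r: "0 < r" "r < 1" using d by (auto simp: r_def)
  define e where "e = (\<lambda>t::nat. real (t + 1) powr (- 3 / 2))"
  have sum_e: "summable e"
    unfolding e_def using summable_Suc_iff[of "\<lambda>n. real n powr (- 3 / 2)"]
    by (simp add: summable_real_powr_iff)
  have e_nonneg: "0 \<le> e t" for t by (simp add: e_def)
  define D where "D = sqrt (4 * real d) ^ 3"
  \<comment> \<open>Three contributions from the times \<open>t < N ^ (d - 1)\<close>: a geometric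
    series, \<open>N ^ (d - 1)\<close> terms equal to \<open>1 / N ^ (d - 1)\<close>, and a
    convergent series with terms of order \<open>t powr (- 3 / 2)\<close>.\<close>
  define C where "C = d * (1 / (1 - r)) + 4 ^ (d - 1) * (1 + D * suminf e)"
  have step: "d * exp (- real t / (4 * real d)) + (2 / N + 2 / sqrt (real t / (4 * real d) + 1)) ^ (d - 1)
      \<le> d * r ^ t + 4 ^ (d - 1) * (1 / N ^ (d - 1) + D * e t)" if N: "0 < N" for N t :: nat
  proof -
    have 1: "exp (- real t / (4 * real d)) = r ^ t"
      unfolding r_def by (simp add: exp_of_nat_mult[symmetric] field_simps)
    define v where "v = real t / (4 * real d) + 1"
    have v: "1 \<le> v" "(t + 1) / (4 * real d) \<le> v" using d by (auto simp: v_def field_simps)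
    have sq: "1 \<le> sqrt v" using v by simp
    have "sqrt ((t + 1) / (4 * real d)) \<le> sqrt v" using v by simp
    then have "1 / sqrt v \<le> 1 / sqrt ((t + 1) / (4 * real d))"
      using d sq by (intro divide_left_mono mult_pos_pos) auto
    also have "\<dots> = sqrt (4 * real d) / sqrt (t + 1)" using d by (simp add: real_sqrt_divide)
    finally have 2: "1 / sqrt v \<le> sqrt (4 * real d) / sqrt (t + 1)" .
    \<comment> \<open>As \<open>1 / sqrt v \<le> 1\<close> and \<open>d - 1 \<ge> 3\<close>, the
      exponent may be lowered to 3, which still gives a summable term.\<close>
    have "(1 / sqrt v) ^ (d - 1) \<le> (1 / sqrt v) ^ 3"
      using sq d by (intro power_decreasing) auto
    also have "\<dots> \<le> (sqrt (4 * real d) / sqrt (t + 1)) ^ 3"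
      using 2 sq by (intro power_mono) auto
    also have "\<dots> = D * (1 / sqrt (t + 1)) ^ 3" by (simp add: D_def power_divide)
    also have "(1 / sqrt (t + 1)) ^ 3 = e t"
      by (simp add: e_def powr_half_sqrt[symmetric] powr_minus_divide powr_powr powr_realpow[symmetric] power_one_over)
    finally have 3: "(1 / sqrt v) ^ (d - 1) \<le> D * e t" .
    define a b where "a = 1 / real N" and "b = 1 / sqrt v"
    have ab: "0 \<le> a" "0 \<le> b" using sq by (auto simp: a_def b_def)
    have "(2 / N + 2 / sqrt v) ^ (d - 1) = (2 * a + 2 * b) ^ (d - 1)" by (simp add: a_def b_def)
    also have "\<dots> \<le> (4 * max a b) ^ (d - 1)" using ab by (intro power_mono) auto
    also have "\<dots> \<le> 4 ^ (d - 1) * (a ^ (d - 1) + b ^ (d - 1))"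
      using ab by (auto simp: power_mult_distrib max_def)
    also have "\<dots> \<le> 4 ^ (d - 1) * (1 / N ^ (d - 1) + D * e t)"
      using 3 by (simp add: a_def b_def power_one_over)
    finally show ?thesis unfolding 1 v_def by simp
  qed
  show ?thesis
  proof (intro exI[of _ C] conjI allI ballI impI)
    have "0 \<le> suminf e" using sum_e e_nonneg by (rule suminf_nonneg)
    moreover have "0 \<le> D" by (simp add: D_def)
    moreover have "0 < d * (1 / (1 - r))" using d r by simp
    ultimately show "0 < C" unfolding C_def
      by (intro add_pos_nonneg mult_nonneg_nonneg add_nonneg_nonneg) auto
    fix N :: nat and j x y assume N: "0 < N" and j: "j \<in> {1..d}"
    have "(\<Sum>t<N ^ (d - 1). wavg (unit_steps d) t (\<lambda>w. of_bool (foldl vadd x w \<in> torus_line d N y j)))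
        \<le> (\<Sum>t<N ^ (d - 1). d * r ^ t + 4 ^ (d - 1) * (1 / N ^ (d - 1) + D * e t))"
      by (intro sum_mono order.trans[OF wavg_torus_line_le[OF N j] step[OF N]])
    also have "\<dots> = d * (\<Sum>t<N ^ (d - 1). r ^ t) + 4 ^ (d - 1) * (1 + D * (\<Sum>t<N ^ (d - 1). e t))"
      using N by (simp add: sum.distrib sum_distrib_left[symmetric])
    also have "\<dots> \<le> C"
    proof -
      have "(\<Sum>t<N ^ (d - 1). r ^ t) \<le> (\<Sum>t. r ^ t)"
        using r by (intro sum_le_suminf summable_geometric) auto
      then have "(\<Sum>t<N ^ (d - 1). r ^ t) \<le> 1 / (1 - r)"
        using r by (simp add: suminf_geometric)
      moreover have "(\<Sum>t<N ^ (d - 1). e t) \<le> suminf e"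
        using sum_e e_nonneg by (intro sum_le_suminf) auto
      ultimately show ?thesis
        unfolding C_def by (intro add_mono mult_left_mono order_refl) (auto simp: D_def)
    qed
    finally show "(\<Sum>t<N ^ (d - 1). wavg (unit_steps d) t (\<lambda>w. of_bool (foldl vadd x w \<in> torus_line d N y j))) \<le> C" .
  qed
qed

section \<open>Hitting all blocks of a line\<close>

text \<open>Visits to \<open>B\<close> at times before \<open>k\<close> are ignored; this delay turns, by stationarity, the uniform start
  into a gap before the first cluster.\<close>
primrec unhit :: "(nat \<Rightarrow> int) set \<Rightarrow> (int \<Rightarrow> 'b set) \<Rightarrow> nat \<Rightarrow> nat \<Rightarrow> (nat \<Rightarrow> int) \<Rightarrow>
    (nat \<Rightarrow> int) list \<Rightarrow> 'b set \<Rightarrow> 'b set" where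
  "unhit B blk j k x [] A = A"
| "unhit B blk j k x (s # w) A =
     unhit B blk j (k - 1) (vadd x s) w (if k = 0 \<and> x \<in> B then A - blk (x j) else A)"

text \<open>The data that \<open>hit_avg\<close> reads: the times of the counted visits and of the
  steps along \<open>e\<^sub>j\<close>. If \<open>B\<close> ignores coordinate \<open>j\<close>, the
  starting value of that coordinate does not affect the record (\<open>trace_cong\<close>), and
  \<open>hit_avg\<close> can average over its path.\<close>

primrec visit_trace :: "(nat \<Rightarrow> int) set \<Rightarrow> nat \<Rightarrow> nat \<Rightarrow> (nat \<Rightarrow> int) \<Rightarrow> (nat \<Rightarrow> int) list \<Rightarrow> (bool \<times> bool) list" where
  "visit_trace B j k x [] = []"
| "visit_trace B j k x (s # w) = (k = 0 \<and> x \<in> B, s j \<noteq> 0) # visit_trace B j (k - 1) (vadd x s) w"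

lemma unhit_append:
  "unhit B blk j k x (u @ v) A = unhit B blk j (k - length u) (foldl vadd x u) v (unhit B blk j k x u A)"
  by (induction u arbitrary: k x A) auto

lemma unhit_delayed: "length u \<le> k \<Longrightarrow> unhit B blk j k x u A = A"
  by (induction u arbitrary: k x A) auto

lemma unhit_subset: "unhit B blk j k x w A \<subseteq> A"
proof (induction w arbitrary: k x A)
  case (Cons s w)
  show ?case using Cons[of "k - 1" "vadd x s" "if k = 0 \<and> x \<in> B then A - blk (x j) else A"] by auto
qed simp

lemma unhit_disjoint:
  "t < length w \<Longrightarrow> foldl vadd x (take t w) \<in> B \<Longrightarrow>
    unhit B blk j 0 x w A \<inter> blk (foldl vadd x (take t w) j) = {}"
proof (induction w arbitrary: t x A)
  case (Cons s w)
  then show ?case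
    using unhit_subset[of B blk j 0 "vadd x s" w "A - blk (x j)"] by (cases t) auto
qed simp

lemma trace_take: "take m (visit_trace B j k x w) = visit_trace B j k x (take m w)"
  by (induction w arbitrary: m k x) (auto simp: take_Cons split: nat.split)

lemma trace_drop:
  "drop a (visit_trace B j k x w) = visit_trace B j (k - a) (foldl vadd x (take a w)) (drop a w)"
  by (induction w arbitrary: a k x) (auto simp: drop_Cons split: nat.split)

lemma length_trace [simp]: "length (visit_trace B j k x w) = length w"
  by (induction w arbitrary: k x) auto

lemma marks_trace_le: "marks (visit_trace B j k x w) \<le> visits vadd B x w"
proof (induction w arbitrary: k x)
  case (Cons s w)
  show ?case using Cons[of "k - 1" "vadd x s"] by (cases "k = 0") auto
qed simp

lemma marks_trace_delayed: "length w \<le> k \<Longrightarrow> marks (visit_trace B j k x w) = 0"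
  by (induction w arbitrary: k x) auto

lemma moves_trace: "moves (visit_trace B j k x w) = step_count j w"
  by (induction w arbitrary: k x) (auto simp: step_count_def)

lemma trace_cong:
  assumes "\<And>x x'. (\<And>i. i \<noteq> j \<Longrightarrow> x i = x' i) \<Longrightarrow> x \<in> B \<longleftrightarrow> x' \<in> B"
  shows "(\<And>i. i \<noteq> j \<Longrightarrow> x i = x' i) \<Longrightarrow> visit_trace B j k x w = visit_trace B j k x' w"
proof (induction w arbitrary: k x x')
  case (Cons s w)
  have "visit_trace B j (k - 1) (vadd x s) w = visit_trace B j (k - 1) (vadd x' s) w"
    using Cons.prems by (intro Cons.IH) (auto simp: vadd_def)
  moreover have "x \<in> B \<longleftrightarrow> x' \<in> B" using Cons.prems by (rule assms)
  ultimately show ?case by simp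
qed simp

text \<open>The law of the walk is unchanged when each step along \<open>e\<^sub>j\<close> is reflected by an independent
  fair coin, and these reflections do not affect the times spent on the line.\<close>
lemma wavg_unhit_eq_hit_avg:
  assumes B: "\<And>x x'. (\<And>i. i \<noteq> j \<Longrightarrow> x i = x' i) \<Longrightarrow> x \<in> B \<longleftrightarrow> x' \<in> B"
  shows "wavg (unit_steps d) n (\<lambda>w. g (unhit B blk j k x w A)) =
    wavg (unit_steps d) n (\<lambda>w. hit_avg blk (\<lambda>_. g) (visit_trace B j k x w) (x j) A)"
proof (induction n arbitrary: k x A)
  case 0
  then show ?case by simp
next
  case (Suc n)
  let ?S = "unit_steps d"
  let ?A = "if k = 0 \<and> x \<in> B then A - blk (x j) else A"
  let ?T = "\<lambda>y z w. hit_avg blk (\<lambda>_. g) (visit_trace B j (k - 1) y w) z ?A"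
  define h where "h = (\<lambda>s. wavg ?S n (\<lambda>w. ?T (vadd x s) (x j + s j) w))"
  have "wavg ?S (Suc n) (\<lambda>w. g (unhit B blk j k x w A)) = avg ?S h"
    unfolding wavg.simps(2) unhit.simps(2) Suc.IH h_def by (simp add: vadd_def)
  also have "\<dots> = avg ?S (\<lambda>s. 1 / 2 * (h s + h (reflect j s)))"
    by (simp only: avg_cmult avg_add avg_reflect) simp
  also have "\<dots> = avg ?S (\<lambda>s. wavg ?S n (\<lambda>w. hit_avg blk (\<lambda>_. g) (visit_trace B j k x (s # w)) (x j) A))"
  proof (rule avg_cong)
    fix s assume s: "s \<in> ?S"
    have eq: "visit_trace B j (k - 1) (vadd x (reflect j s)) w = visit_trace B j (k - 1) (vadd x s) w" for w
      using s by (intro trace_cong[OF B]) (auto simp: vadd_def reflect_def unit_vec_def elim!: unit_stepsE split: if_splits)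
    have sj: "s j = 0 \<or> s j = 1 \<or> s j = -1"
      using s by (auto simp: unit_vec_def elim!: unit_stepsE split: if_splits)
    have "1 / 2 * (h s + h (reflect j s)) =
        wavg ?S n (\<lambda>w. 1 / 2 * (?T (vadd x s) (x j + s j) w + ?T (vadd x s) (x j + reflect j s j) w))"
      unfolding h_def eq by (simp only: wavg_cmult wavg_add)
    also have "\<dots> = wavg ?S n (\<lambda>w. hit_avg blk (\<lambda>_. g) (visit_trace B j k x (s # w)) (x j) A)"
      using sj by (intro wavg_cong) (auto simp: reflect_def Let_def)
    finally show "1 / 2 * (h s + h (reflect j s)) = \<dots>" .
  qed
  finally show ?case by simp
qed

section \<open>Division of time into periods\<close>

primrec chunks :: "nat \<Rightarrow> nat \<Rightarrow> 'a list \<Rightarrow> 'a list list" where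
  "chunks m 0 l = []"
| "chunks m (Suc n) l = take m l # chunks m n (drop m l)"

lemma concat_chunks: "concat (chunks m n l) = take (n * m) l"
  by (induction n arbitrary: l) (auto simp: take_add)

lemma drop_chunks: "drop i (chunks m n l) = chunks m (n - i) (drop (i * m) l)"
proof (induction n arbitrary: i l)
  case (Suc n)
  then show ?case by (cases i) (auto simp: add.commute)
qed simp

lemma take_chunks: "take s (chunks m n l) = chunks m (min s n) l"
proof (induction n arbitrary: s l)
  case (Suc n)
  then show ?case by (cases s) auto
qed simp

lemma in_set_chunks: "w \<in> set (chunks m n l) \<Longrightarrow> \<exists>i<n. w = take m (drop (i * m) l)"
proof (induction n arbitrary: l)
  case (Suc n)
  show ?case
  proof (cases "w = take m l")
    case True
    then show ?thesis by (intro exI[of _ 0]) simp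
  next
    case False
    then have "w \<in> set (chunks m n (drop m l))" using Suc.prems by simp
    from Suc.IH[OF this] obtain i where "i < n" "w = take m (drop (i * m) (drop m l))" by blast
    then show ?thesis by (intro exI[of _ "Suc i"]) (simp add: add.commute)
  qed
qed simp

lemma hit_avg_le_1:
  assumes "\<And>z A. g z A \<le> 1" shows "hit_avg blk g l z A \<le> 1"
proof (induction l arbitrary: z A)
  case (Cons e l)
  show ?case
    using Cons[of "z + 1" "if fst e then A - blk z else A"] Cons[of "z - 1" "if fst e then A - blk z else A"]
      Cons[of z "if fst e then A - blk z else A"] by (auto simp: Let_def)
qed (use assms in auto)

text \<open>Union bound. The periods of length \<open>m\<close> satisfy the hypotheses of
  \<open>hit_avg_all_hit_le\<close> outside the following events: \<open>e1\<close>, at least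
  \<open>V\<close> visits in all; \<open>e2 i\<close>, at least \<open>s\<close> visits in the
  window of \<open>s\<close> periods from the \<open>i\<close>-th; \<open>e3 i\<close>, fewer than
  \<open>N\<^sup>2\<close> steps along \<open>e\<^sub>j\<close> in period \<open>i\<close>. The
  value of \<open>m\<close> makes \<open>N\<^sup>2\<close> the threshold of
  \<open>step_count_tail\<close>. In the first period visits are ignored, hence
  \<open>Suc k\<close>.\<close>

lemma wavg_all_hit_le:
  fixes d N j s k k' V :: nat and y :: "nat \<Rightarrow> int" and \<eta> C p :: real and U :: "'b set"
  defines "S \<equiv> unit_steps d" and "m \<equiv> 4 * d * N\<^sup>2" and "B \<equiv> torus_line d N y j"
  assumes N: "0 < N" and j: "j \<in> {1..d}"
    and green: "\<And>x. (\<Sum>t<N ^ (d - 1). wavg S t (\<lambda>w. of_bool (foldl vadd x w \<in> B))) \<le> C"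
    and \<eta>: "0 \<le> \<eta>" "\<eta> * C \<le> 1 / 2"
    and blk: "\<And>z. finite (blk z) \<and> card (blk z) \<le> 1" and U: "finite U"
    and q: "\<And>A n z. A \<subseteq> U \<Longrightarrow> N\<^sup>2 \<le> n \<Longrightarrow> walk_avg n (\<lambda>z. real (card (A \<inter> blk z))) z \<le> p * card A"
    and p: "0 \<le> p" "4 * p * s \<le> 1" and s: "0 < s"
    and sizes: "s * m \<le> N ^ (d - 1)" "Suc k * m \<le> k' * N ^ (d - 1)"
  shows "wavg S (Suc k * m) (\<lambda>w. of_bool (unhit B blk j m x w U = {}))
    \<le> exp (- (exp (- 4 * p * V) / s) * card U) + 2 ^ k' / (1 + \<eta>) ^ V
      + Suc k * (2 / (1 + \<eta>) ^ s) + Suc k * exp (- (real N)\<^sup>2)"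
proof -
  let ?n = "Suc k * m"
  let ?s = "\<lambda>i. min s (Suc k - i) * m"
  let ?E = "exp (- (exp (- 4 * p * V) / s) * card U)"
  have S: "finite S" "S \<noteq> {}" using j unit_steps_nonempty[of d] by (auto simp: S_def)
  have B: "x \<in> B \<longleftrightarrow> x' \<in> B" if "\<And>i. i \<noteq> j \<Longrightarrow> x i = x' i" for x x'
    using that by (auto simp: B_def torus_line_def)
  define e1 where "e1 = (\<lambda>w. of_bool (V \<le> visits vadd B x w) :: real)"
  define e2 where "e2 = (\<lambda>i w. of_bool (s \<le> visits vadd B (foldl vadd x (take (i * m) w)) (take (?s i) (drop (i * m) w))) :: real)"
  define e3 where "e3 = (\<lambda>i w. of_bool (step_count j (take m (drop (i * m) w)) < N\<^sup>2) :: real)"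
  have e_nonneg: "0 \<le> e1 w" "0 \<le> e2 i w" "0 \<le> e3 i w" for w i by (auto simp: e1_def e2_def e3_def)
  have "wavg S ?n (\<lambda>w. of_bool (unhit B blk j m x w U = {}))
      = wavg S ?n (\<lambda>w. hit_avg blk (\<lambda>_ A. of_bool (A = {})) (visit_trace B j m x w) (x j) U)"
    unfolding S_def by (rule wavg_unhit_eq_hit_avg[OF B])
  also have "\<dots> \<le> wavg S ?n (\<lambda>w. ?E + e1 w + (\<Sum>i<Suc k. e2 i w) + (\<Sum>i<Suc k. e3 i w))"
  proof (rule wavg_mono)
    fix w :: "(nat \<Rightarrow> int) list" assume w: "length w = ?n"
    let ?l = "visit_trace B j m x w"
    let ?T = "hit_avg blk (\<lambda>_ A. of_bool (A = {})) ?l (x j) U"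
    show "?T \<le> ?E + e1 w + (\<Sum>i<Suc k. e2 i w) + (\<Sum>i<Suc k. e3 i w)"
    proof (cases "e1 w = 0 \<and> (\<forall>i<Suc k. e2 i w = 0 \<and> e3 i w = 0)")
      case True
      define ws where "ws = chunks m (Suc k) ?l"
      have ws: "concat ws = ?l" using w by (simp only: ws_def concat_chunks) simp
      have visits: "visits vadd B x w < V" using True by (auto simp: e1_def)
      have "?T = hit_avg blk (\<lambda>_ A. of_bool (A = {})) (concat ws) (x j) U" by (simp add: ws)
      also have "\<dots> \<le> exp (- (exp (- 4 * p * marks (concat ws)) / s) * card U)"
      proof (rule hit_avg_all_hit_le[OF blk U _ p s order_refl])
        show "walk_avg n (\<lambda>z. real (card (A \<inter> blk z))) z \<le> p * card A" if "A \<subseteq> U" "N\<^sup>2 \<le> n" for A n z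
          using that by (rule q)
        show "ws = [] \<or> marks (hd ws) = 0"
          by (simp add: ws_def trace_take marks_trace_delayed)
        show "N\<^sup>2 \<le> moves v" if "v \<in> set ws" for v
        proof -
          obtain i where "i < Suc k" "v = take m (drop (i * m) ?l)"
            using \<open>v \<in> set ws\<close> in_set_chunks unfolding ws_def by blast
          then show ?thesis using True by (auto simp: trace_take trace_drop moves_trace e3_def)
        qed
        show "marks (concat (take s (drop i ws))) < s" for i
        proof (cases "i < Suc k")
          case True
          have "concat (take s (drop i ws)) = take (?s i) (drop (i * m) ?l)"
            unfolding ws_def drop_chunks take_chunks concat_chunks ..
          also have "marks \<dots> \<le> visits vadd B (foldl vadd x (take (i * m) w)) (take (?s i) (drop (i * m) w))"
            unfolding trace_drop trace_take by (rule marks_trace_le)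
          also have "\<dots> < s"
            using True \<open>e1 w = 0 \<and> (\<forall>i<Suc k. e2 i w = 0 \<and> e3 i w = 0)\<close> by (auto simp: e2_def)
          finally show ?thesis .
        next
          case False
          then have "Suc k - i = 0" by simp
          then have "drop i ws = []" by (simp only: ws_def drop_chunks chunks.simps(1))
          then show ?thesis using s by simp
        qed
      qed
      also have "\<dots> \<le> ?E"
      proof -
        have "real (marks ?l) \<le> V" using visits marks_trace_le[of B j m x w] by simp
        then have "4 * p * marks ?l \<le> 4 * p * V" using p by (intro mult_left_mono) auto
        then have "exp (- 4 * p * V) / s * card U \<le> exp (- 4 * p * marks (concat ws)) / s * card U"
          unfolding ws by (intro mult_right_mono divide_right_mono) auto
        then show ?thesis by simp
      qed
      finally show ?thesis using e_nonneg by (simp add: True)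
    next
      case False
      have "?T \<le> 1" by (rule hit_avg_le_1) simp
      moreover have "1 \<le> e1 w + (\<Sum>i<Suc k. e2 i w) + (\<Sum>i<Suc k. e3 i w)"
      proof -
        consider "e1 w = 1" | i where "i < Suc k" "e2 i w = 1" | i where "i < Suc k" "e3 i w = 1"
          using False by (auto simp: e1_def e2_def e3_def)
        then show ?thesis
        proof cases
          case 1
          then show ?thesis using e_nonneg by (simp add: sum_nonneg add_increasing2)
        next
          case (2 i)
          then show ?thesis
            using member_le_sum[of i "{..<Suc k}" "\<lambda>i. e2 i w"] e_nonneg
              sum_nonneg[of "{..<Suc k}" "\<lambda>i. e3 i w"]
            by (simp del: sum.lessThan_Suc) (use e_nonneg(1)[of w] in linarith)
        next
          case (3 i)
          then show ?thesis
            using member_le_sum[of i "{..<Suc k}" "\<lambda>i. e3 i w"] e_nonneg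
              sum_nonneg[of "{..<Suc k}" "\<lambda>i. e2 i w"]
            by (simp del: sum.lessThan_Suc) (use e_nonneg(1)[of w] in linarith)
        qed
      qed
      moreover have "0 \<le> ?E" by simp
      ultimately show ?thesis by linarith
    qed
  qed
  also have "\<dots> = ?E + wavg S ?n e1 + (\<Sum>i<Suc k. wavg S ?n (e2 i)) + (\<Sum>i<Suc k. wavg S ?n (e3 i))"
    by (simp only: wavg_add wavg_const[OF S] wavg_sum[OF finite_lessThan])
  also have "\<dots> \<le> ?E + 2 ^ k' / (1 + \<eta>) ^ V + (\<Sum>i<Suc k. 2 / (1 + \<eta>) ^ s) + (\<Sum>i<Suc k. exp (- (real N)\<^sup>2))"
  proof (intro add_mono sum_mono order_refl)
    show "wavg S ?n e1 \<le> 2 ^ k' / (1 + \<eta>) ^ V"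
      unfolding e1_def using sizes by (intro wavg_visits_tail[OF S green \<eta>])
    fix i assume i: "i \<in> {..<Suc k}"
    then have im: "i * m \<le> ?n" by (intro mult_le_mono1) auto
    show "wavg S ?n (e2 i) \<le> 2 / (1 + \<eta>) ^ s"
      unfolding e2_def
    proof (rule wavg_segment_le[OF S im])
      fix u
      \<comment> \<open>The window fits into one horizon \<open>N ^ (d - 1)\<close> of the Green
        function bound, so its tail bound has a single factor 2.\<close>
      have "min (?s i) (?n - i * m) \<le> 1 * N ^ (d - 1)"
        using sizes(1) by (metis le_trans min.cobounded1 mult_1 mult_le_mono1)
      from wavg_visits_tail[OF S green \<eta> this]
      show "wavg S (min (?s i) (?n - i * m)) (\<lambda>v. of_bool (s \<le> visits vadd B (foldl vadd x u) v)) \<le> 2 / (1 + \<eta>) ^ s"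
        by simp
    qed
    show "wavg S ?n (e3 i) \<le> exp (- (real N)\<^sup>2)"
      unfolding e3_def
    proof (rule wavg_segment_le[OF S im])
      have "m \<le> ?n - i * m" using i mult_le_mono1[of 1 "Suc k - i" m] unfolding diff_mult_distrib[symmetric]
        by (simp add: Suc_diff_le)
      then have "min m (?n - i * m) = m" by simp
      moreover have "4 * d * step_count j v < m \<longleftrightarrow> step_count j v < N\<^sup>2" for v
        using j by (simp add: m_def)
      moreover have "- real m / (4 * d) = - (real N)\<^sup>2" using j by (simp add: m_def)
      ultimately show "wavg S (min m (?n - i * m)) (\<lambda>v. of_bool (step_count j v < N\<^sup>2)) \<le> exp (- (real N)\<^sup>2)"
        using step_count_tail[OF j, of m] by (simp add: S_def)
    qed
  qed
  finally show ?thesis by simp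
qed

text \<open>A block consists of \<open>l\<close> residues, indexed by the offset \<open>r\<close>,
  and each has probability at most \<open>2 / N + 2 / sqrt (n + 1) \<le> 4 / N\<close>.\<close>

lemma walk_avg_card_block_le:
  fixes N l n :: nat
  assumes N: "0 < N" and l: "0 < l" and n: "N\<^sup>2 \<le> n" and A: "finite A"
  shows "walk_avg n (\<lambda>z. real (card (A \<inter> {nat ((z - a) mod int N div int l)}))) z \<le> 4 * real l / N * card A"
proof -
  let ?g = "\<lambda>(b, r) z. of_bool (int N dvd z - (a + int b * int l + int r)) :: real"
  have "walk_avg n (\<lambda>z. real (card (A \<inter> {nat ((z - a) mod int N div int l)}))) z
      \<le> walk_avg n (\<lambda>z. \<Sum>q\<in>A \<times> {..<l}. ?g q z) z"
  proof (rule walk_avg_mono)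
    fix z
    define b where "b = nat ((z - a) mod int N div int l)"
    define r where "r = nat ((z - a) mod int N mod int l)"
    show "real (card (A \<inter> {nat ((z - a) mod int N div int l)})) \<le> (\<Sum>q\<in>A \<times> {..<l}. ?g q z)"
    proof (cases "b \<in> A")
      case True
      have "int b * int l + int r = (z - a) mod int N"
        using N l by (simp add: b_def r_def pos_imp_zdiv_nonneg_iff)
      then have "z - (a + int b * int l + int r) = int N * ((z - a) div int N)"
        using mult_div_mod_eq[of "int N" "z - a"] by linarith
      then have "?g (b, r) z = 1" by simp
      moreover have "(b, r) \<in> A \<times> {..<l}" using True l by (simp add: r_def nat_less_iff)
      ultimately have "1 \<le> (\<Sum>q\<in>A \<times> {..<l}. ?g q z)"
        using member_le_sum[of "(b, r)" "A \<times> {..<l}" "\<lambda>q. ?g q z"] A by auto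
      then show ?thesis using True by (simp add: b_def[symmetric])
    next
      case False
      then show ?thesis by (auto simp: b_def[symmetric] intro!: sum_nonneg)
    qed
  qed
  also have "\<dots> = (\<Sum>q\<in>A \<times> {..<l}. walk_avg n (?g q) z)" using A by (intro walk_avg_sum) auto
  also have "\<dots> \<le> (\<Sum>q\<in>A \<times> {..<l}. 4 / N)"
  proof (intro sum_mono)
    fix q assume "q \<in> A \<times> {..<l}"
    obtain b r where q: "q = (b, r)" by fastforce
    have "(real N)\<^sup>2 \<le> real (n + 1)" using n by (metis le_add1 le_trans of_nat_le_iff of_nat_power)
    then have "real N \<le> sqrt (real (n + 1))" by (rule real_le_rsqrt)
    then have "2 / sqrt (real (n + 1)) \<le> 2 / N" using N by (intro divide_left_mono) auto
    then show "walk_avg n (?g q) z \<le> 4 / N"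
      using walk_avg_residue_le[OF N, of n "a + int b * int l + int r" z] by (simp add: q add.commute)
  qed
  also have "\<dots> = 4 * real l / N * card A" by (simp add: card_cartesian_product)
  finally show ?thesis .
qed

section \<open>From words to the random walk\<close>

lemma avg_swap: "avg S (\<lambda>s. avg T (\<lambda>t. f s t)) = avg T (\<lambda>t. avg S (\<lambda>s. f s t))"
  unfolding avg_def by (simp add: sum_divide_distrib[symmetric] sum.swap[of _ S T] mult.commute)

lemma torus_nonempty: "0 < N \<Longrightarrow> torus d N \<noteq> {}"
  unfolding torus_def by (auto simp: PiE_eq_empty_iff)

lemma card_torus: "card (torus d N) = N ^ d"
  unfolding torus_def by (simp add: card_PiE)

lemma torus_add_in_torus: "0 < N \<Longrightarrow> torus_add d N x v \<in> torus d N"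
  unfolding torus_add_def torus_def by auto

lemma torus_add_inverse:
  assumes "x \<in> torus d N" "\<And>i. v i + v' i = 0"
  shows "torus_add d N (torus_add d N x v) v' = x"
proof
  fix i
  show "torus_add d N (torus_add d N x v) v' i = x i"
  proof (cases "i \<in> {1..d}")
    case True
    have "torus_add d N (torus_add d N x v) v' i = ((x i + v i) mod int N + v' i) mod int N"
      using True by (simp add: torus_add_def)
    also have "\<dots> = (x i + v i + v' i) mod int N" by (rule mod_add_left_eq)
    also have "x i + v i + v' i = x i" using assms(2)[of i] by linarith
    also have "x i mod int N = x i" using True assms(1) by (auto simp: torus_def PiE_iff)
    finally show ?thesis .
  next
    case False
    then have "x i = undefined" using assms(1) unfolding torus_def by (rule PiE_arb[rotated])
    then show ?thesis unfolding torus_add_def using False by (simp only: restrict_apply if_False)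
  qed
qed

text \<open>Since \<open>F\<close> depends only on residues, translation by \<open>s\<close> acts as
  a bijection of the torus.\<close>

lemma avg_torus_vadd:
  assumes N: "0 < N"
    and F: "\<And>x x'. (\<And>i. i \<in> {1..d} \<Longrightarrow> int N dvd x i - x' i) \<Longrightarrow> F x = F x'"
  shows "avg (torus d N) (\<lambda>x. F (vadd x s)) = avg (torus d N) F"
proof -
  have "avg (torus d N) (\<lambda>x. F (vadd x s)) = avg (torus d N) (\<lambda>x. F (torus_add d N x s))"
    by (intro avg_cong F) (auto simp: vadd_def torus_add_def minus_mod_eq_mult_div)
  also have "\<dots> = avg (torus d N) F"
  proof (rule avg_bij)
    show "bij_betw (\<lambda>x. torus_add d N x s) (torus d N) (torus d N)"
      by (rule bij_betw_byWitness[where f' = "\<lambda>x. torus_add d N x (\<lambda>i. - s i)"])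
        (auto simp: torus_add_inverse torus_add_in_torus N)
  qed
  finally show ?thesis .
qed

lemma foldl_vadd: "foldl vadd x w i = x i + (\<Sum>s\<leftarrow>w. s i)"
  by (induction w arbitrary: x) (auto simp: vadd_def)

lemma avg_torus_walk:
  assumes N: "0 < N" and S: "finite S" "S \<noteq> {}"
    and F: "\<And>x x'. (\<And>i. i \<in> {1..d} \<Longrightarrow> int N dvd x i - x' i) \<Longrightarrow> F x = F x'"
  shows "avg (torus d N) (\<lambda>x. wavg S m (\<lambda>u. F (foldl vadd x u))) = avg (torus d N) F"
proof (induction m)
  case (Suc m)
  have "avg (torus d N) (\<lambda>x. wavg S (Suc m) (\<lambda>u. F (foldl vadd x u)))
      = avg S (\<lambda>s. avg (torus d N) (\<lambda>x. wavg S m (\<lambda>u. F (foldl vadd (vadd x s) u))))"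
    by (simp add: avg_swap[of S])
  also have "\<dots> = avg S (\<lambda>s. avg (torus d N) (\<lambda>x. wavg S m (\<lambda>u. F (foldl vadd x u))))"
  proof (rule avg_cong, rule avg_torus_vadd[OF N, where F = "\<lambda>x. wavg S m (\<lambda>u. F (foldl vadd x u))"])
    fix x x' :: "nat \<Rightarrow> int"
    assume "\<And>i. i \<in> {1..d} \<Longrightarrow> int N dvd x i - x' i"
    then show "wavg S m (\<lambda>u. F (foldl vadd x u)) = wavg S m (\<lambda>u. F (foldl vadd x' u))"
      by (intro wavg_cong F) (simp add: foldl_vadd)
  qed
  finally show ?case using Suc by (simp add: avg_const[OF S])
qed simp

lemma unhit_cong:
  assumes j: "j \<in> {1..d}" and blk: "\<And>z z'. int N dvd z - z' \<Longrightarrow> blk z = blk z'"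
  shows "(\<And>i. i \<in> {1..d} \<Longrightarrow> int N dvd x i - x' i) \<Longrightarrow>
    unhit (torus_line d N y j) blk j k x w A = unhit (torus_line d N y j) blk j k x' w A"
proof (induction w arbitrary: x x' k A)
  case (Cons s w)
  have "int N dvd x i - y i \<longleftrightarrow> int N dvd x' i - y i" if "i \<in> {1..d}" for i
    using dvd_add_right_iff[OF Cons.prems[OF that], of "x' i - y i"] by simp
  then have "x \<in> torus_line d N y j \<longleftrightarrow> x' \<in> torus_line d N y j" by (auto simp: torus_line_def)
  moreover have "blk (x j) = blk (x' j)" using Cons.prems[OF j] by (rule blk)
  moreover have "unhit (torus_line d N y j) blk j (k - 1) (vadd x s) w A'
      = unhit (torus_line d N y j) blk j (k - 1) (vadd x' s) w A'" for A'
    using Cons.prems by (intro Cons.IH) (simp add: vadd_def)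
  ultimately show ?case by simp
qed simp

text \<open>By stationarity, \<open>m\<close> preliminary steps during which visits are ignored do
  not change the law of the later walk modulo \<open>N\<close>.\<close>

lemma avg_torus_unhit:
  assumes N: "0 < N" and j: "j \<in> {1..d}" and blk: "\<And>z z'. int N dvd z - z' \<Longrightarrow> blk z = blk z'"
  shows "avg (torus d N) (\<lambda>x. wavg (unit_steps d) n (\<lambda>w. g (unhit (torus_line d N y j) blk j 0 x w A)))
    = avg (torus d N) (\<lambda>x. wavg (unit_steps d) (m + n) (\<lambda>w. g (unhit (torus_line d N y j) blk j m x w A)))"
proof -
  let ?S = "unit_steps d" and ?B = "torus_line d N y j"
  define F where "F = (\<lambda>x. wavg ?S n (\<lambda>w. g (unhit ?B blk j 0 x w A)))"
  have S: "finite ?S" "?S \<noteq> {}" using j unit_steps_nonempty[of d] by auto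
  have F: "F x = F x'" if "\<And>i. i \<in> {1..d} \<Longrightarrow> int N dvd x i - x' i" for x x'
    unfolding F_def using unhit_cong[OF j blk that] by simp
  have "wavg ?S (m + n) (\<lambda>w. g (unhit ?B blk j m x w A)) = wavg ?S m (\<lambda>u. F (foldl vadd x u))" for x
    unfolding wavg_append F_def
    by (intro wavg_cong) (simp add: unhit_append unhit_delayed)
  then show ?thesis using avg_torus_walk[OF N S, of d F m] F by (simp add: F_def)
qed

section \<open>Transfer to the probability space of the walk\<close>

lemma srw_cylinder:
  assumes N: "0 < N" and d: "0 < d" and x: "x \<in> torus d N" and w: "set w \<subseteq> unit_steps d"
  defines "Z \<equiv> {\<omega>. fst \<omega> = x \<and> (\<forall>i<length w. snd \<omega> i = w ! i)}"
  shows "Z \<in> sets (srw_space d N)"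
    and "measure (srw_space d N) Z = 1 / (card (torus d N) * real (card (unit_steps d)) ^ length w)"
proof -
  let ?A = "measure_pmf (pmf_of_set (torus d N))" and ?M = "\<lambda>_::nat. measure_pmf (pmf_of_set (unit_steps d))"
  let ?P = "PiM UNIV ?M"
  interpret A: prob_space ?A by (rule prob_space_measure_pmf)
  interpret B: product_prob_space ?M UNIV by unfold_locales
  define E where "E = prod_emb UNIV ?M {..<length w} (\<Pi>\<^sub>E i\<in>{..<length w}. {w ! i})"
  have E: "E \<in> sets ?P" unfolding E_def by (rule sets_PiM_I) auto
  have Z: "Z = {x} \<times> E"
  proof -
    have "E = (\<Pi>\<^sub>E i\<in>UNIV. if i \<in> {..<length w} then {w ! i} else space (?M i))"
      unfolding E_def by (rule prod_emb_PiE) auto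
    then have "f \<in> E \<longleftrightarrow> (\<forall>i<length w. f i = w ! i)" for f
      by (simp add: PiE_iff)
    then show ?thesis by (auto simp: Z_def)
  qed
  then show "Z \<in> sets (srw_space d N)" using E by (simp add: srw_space_def)
  have wS: "w ! i \<in> unit_steps d" if "i < length w" for i using w that by (meson nth_mem subsetD)
  have "measure ?P E = (\<Prod>i\<in>{..<length w}. measure (measure_pmf (pmf_of_set (unit_steps d))) {w ! i})"
    unfolding E_def by (rule B.measure_PiM_emb) auto
  also have "\<dots> = (1 / real (card (unit_steps d))) ^ length w"
    using wS unit_steps_nonempty[OF d] by (simp add: measure_pmf_single)
  finally have mE: "measure ?P E = (1 / real (card (unit_steps d))) ^ length w" .
  have "emeasure (srw_space d N) Z = emeasure ?A {x} * emeasure ?P E"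
    unfolding srw_space_def Z by (rule B.emeasure_pair_measure_Times) (use E in auto)
  then have "measure (srw_space d N) Z = measure ?A {x} * measure ?P E"
    by (simp add: measure_def enn2real_mult)
  then show "measure (srw_space d N) Z = 1 / (card (torus d N) * real (card (unit_steps d)) ^ length w)"
    unfolding mE using x torus_nonempty[OF N] by (simp add: measure_pmf_single finite_torus power_one_over)
qed

text \<open>\<open>E\<close> contains the disjoint cylinders of all good pairs
  \<open>(x, w)\<close>. By \<open>srw_cylinder\<close> these have equal probability, so their total
  measure is the proportion of good pairs.\<close>

lemma measure_srw_ge:
  assumes N: "0 < N" and d: "0 < d" and E: "E \<in> sets (srw_space d N)"
    and good: "\<And>x w \<omega>. x \<in> torus d N \<Longrightarrow> set w \<subseteq> unit_steps d \<Longrightarrow> length w = n \<Longrightarrow> \<not> bad x w \<Longrightarrow>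
      fst \<omega> = x \<Longrightarrow> (\<And>i. i < n \<Longrightarrow> snd \<omega> i = w ! i) \<Longrightarrow> \<omega> \<in> E"
  shows "1 - avg (torus d N) (\<lambda>x. wavg (unit_steps d) n (\<lambda>w. of_bool (bad x w))) \<le> measure (srw_space d N) E"
proof -
  let ?S = "unit_steps d" and ?M = "srw_space d N"
  interpret prob_space ?M by (rule prob_space_srw_space)
  have S: "finite ?S" "?S \<noteq> {}" using d unit_steps_nonempty[of d] by auto
  define W where "W = {w. set w \<subseteq> ?S \<and> length w = n}"
  define G where "G = {(x, w). x \<in> torus d N \<and> w \<in> W \<and> \<not> bad x w}"
  define Z :: "(nat \<Rightarrow> int) \<times> (nat \<Rightarrow> int) list \<Rightarrow> ((nat \<Rightarrow> int) \<times> (nat \<Rightarrow> nat \<Rightarrow> int)) set"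
    where "Z = (\<lambda>(x, w). {\<omega>. fst \<omega> = x \<and> (\<forall>i<length w. snd \<omega> i = w ! i)})"
  define c where "c = 1 / (card (torus d N) * real (card ?S) ^ n)"
  have finW: "finite W" unfolding W_def using S(1) by (rule finite_lists_length_eq)
  have finG: "finite G"
    by (rule finite_subset[of _ "torus d N \<times> W"]) (auto simp: G_def finW finite_torus)
  have Zsets: "Z g \<in> sets ?M" and Zmeas: "measure ?M (Z g) = c" if "g \<in> G" for g
    using that srw_cylinder[OF N d] by (auto simp: G_def W_def Z_def c_def)
  have disj: "disjoint_family_on Z G"
    unfolding disjoint_family_on_def by (auto simp: Z_def G_def W_def intro!: nth_equalityI)
  have "1 - avg (torus d N) (\<lambda>x. wavg ?S n (\<lambda>w. of_bool (bad x w)))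
      = avg (torus d N) (\<lambda>x. wavg ?S n (\<lambda>w. 1 + (- 1) * of_bool (bad x w)))"
    using S torus_nonempty[OF N] by (simp only: avg_add wavg_add avg_cmult wavg_cmult avg_const[OF finite_torus torus_nonempty[OF N]] wavg_const[OF S])
  also have "\<dots> = avg (torus d N) (\<lambda>x. wavg ?S n (\<lambda>w. of_bool (\<not> bad x w)))"
    by (intro avg_cong wavg_cong) auto
  also have "\<dots> = (\<Sum>x\<in>torus d N. \<Sum>w\<in>W. c * of_bool (\<not> bad x w))"
    unfolding avg_def wavg_eq_sum[OF S(1)] W_def[symmetric] c_def
    by (simp add: sum_divide_distrib sum_distrib_left[symmetric] mult.commute)
  also have "\<dots> = (\<Sum>g\<in>torus d N \<times> W. if g \<in> G then c else 0)"
    unfolding sum.cartesian_product by (intro sum.cong) (auto simp: G_def)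
  also have "\<dots> = (\<Sum>g\<in>G. c)"
  proof -
    have "(torus d N \<times> W) \<inter> G = G" by (auto simp: G_def)
    then show ?thesis using finW finite_torus by (simp add: sum.inter_restrict[symmetric] finite_cartesian_product)
  qed
  also have "\<dots> = (\<Sum>g\<in>G. measure ?M (Z g))" using Zmeas by simp
  also have "\<dots> = measure ?M (\<Union>g\<in>G. Z g)"
    using finG Zsets disj by (intro finite_measure_finite_Union[symmetric]) auto
  also have "\<dots> \<le> measure ?M E"
  proof (intro finite_measure_mono E)
    show "(\<Union>g\<in>G. Z g) \<subseteq> E" using good by (auto simp: G_def Z_def W_def)
  qed
  finally show ?thesis .
qed

lemma srw_eq_foldl:
  assumes w: "\<And>i. i < length w \<Longrightarrow> snd \<omega> i = w ! i"
  shows "t \<le> length w \<Longrightarrow> i \<in> {1..d} \<Longrightarrow> int N dvd srw d N t \<omega> i - foldl vadd (fst \<omega>) (take t w) i"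
proof (induction t)
  case (Suc t)
  have "srw d N (Suc t) \<omega> i = (srw d N t \<omega> i + (w ! t) i) mod int N"
    using Suc.prems w[of t] by (simp add: torus_add_def)
  moreover have "foldl vadd (fst \<omega>) (take (Suc t) w) i = foldl vadd (fst \<omega>) (take t w) i + (w ! t) i"
    using Suc.prems by (simp add: take_Suc_conv_app_nth vadd_def)
  moreover have "int N dvd srw d N t \<omega> i - foldl vadd (fst \<omega>) (take t w) i"
    using Suc by simp
  moreover have "(srw d N t \<omega> i + (w ! t) i) mod int N = (foldl vadd (fst \<omega>) (take t w) i + (w ! t) i) mod int N"
    if "int N dvd srw d N t \<omega> i - foldl vadd (fst \<omega>) (take t w) i"
    using that by (intro mod_add_cong refl) (simp only: mod_eq_dvd_iff)
  ultimately have "srw d N (Suc t) \<omega> i mod int N = foldl vadd (fst \<omega>) (take (Suc t) w) i mod int N"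
    by (simp only: mod_mod_trivial)
  then show ?case by (simp only: mod_eq_dvd_iff)
qed simp

text \<open>For a surviving block \<open>b\<close> the witness is the offset \<open>b * l\<close>. A
  visited point of the segment starting there would lie on the line and in block \<open>b\<close>:
  its offset \<open>k\<close> within the block is less than \<open>l\<close>, and blocks do not wrap
  around the torus because \<open>M * l \<le> N\<close>.\<close>

lemma vacant_eventI:
  fixes l M :: nat and t :: real
  assumes N: "0 < N" and \<omega>: "fst \<omega> = x" "\<And>i. i < length w \<Longrightarrow> snd \<omega> i = w ! i"
    and t: "t < real (length w)" and l: "\<lfloor>K * ln N\<rfloor> < int l" and M: "M * l \<le> N"
    and small: "\<And>b. b < M \<Longrightarrow> real (b * l) < N powr \<beta>"
    and unhit: "\<And>y j. y \<in> torus d N \<Longrightarrow> j \<in> {1..d} \<Longrightarrow>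
      unhit (torus_line d N y j) (\<lambda>z. {nat ((z - y j) mod int N div int l)}) j 0 x w {..<M} \<noteq> {}"
  shows "\<omega> \<in> vacant_event d N K \<beta> t"
proof -
  have "\<exists>m::int. 0 \<le> m \<and> real_of_int m < N powr \<beta> \<and>
      trajectory d N t \<omega> \<inter> segment_at d N K y j m = {}" if y: "y \<in> torus d N" and j: "j \<in> {1..d}" for y j
  proof -
    let ?B = "torus_line d N y j" and ?blk = "\<lambda>z. {nat ((z - y j) mod int N div int l)}"
    obtain b where b: "b \<in> unhit ?B ?blk j 0 x w {..<M}" using unhit[OF y j] by blast
    have bM: "b < M" using b unhit_subset[of ?B ?blk j 0 x w "{..<M}"] by auto
    have "z \<notin> segment_at d N K y j (int (b * l))" if traj: "z \<in> trajectory d N t \<omega>" for z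
    proof
      assume "z \<in> segment_at d N K y j (int (b * l))"
      then obtain k where z: "z = torus_add d N y (\<lambda>i. (int (b * l) + k) * unit_vec j i)"
        and k: "0 \<le> k" "k \<le> \<lfloor>K * ln N\<rfloor>" by (auto simp: segment_at_def)
      have kl: "k < int l" using k l by linarith
      obtain r where r: "real r \<le> t" "srw d N r \<omega> = z" using traj by (auto simp: trajectory_def)
      have walk_avg: "r < length w" using r t by simp
      let ?p = "foldl vadd x (take r w)"
      have p: "int N dvd z i - ?p i" if "i \<in> {1..d}" for i
        using srw_eq_foldl[OF \<omega>(2), of r i d N] walk_avg r \<omega>(1) that by simp
      have zi: "z i mod int N = (y i + (int (b * l) + k) * unit_vec j i) mod int N" if "i \<in> {1..d}" for i
        using that by (simp add: z torus_add_def)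
      have pmod: "?p i mod int N = (y i + (int (b * l) + k) * unit_vec j i) mod int N" if "i \<in> {1..d}" for i
        using p[OF that] zi[OF that] by (simp add: mod_eq_dvd_iff[symmetric])
      have "?p \<in> ?B"
      proof -
        have "int N dvd ?p i - y i" if "i \<in> {1..d} - {j}" for i
          using pmod[of i] that by (simp add: unit_vec_def mod_eq_dvd_iff[symmetric])
        then show ?thesis by (simp add: torus_line_def)
      qed
      moreover have "nat ((?p j - y j) mod int N div int l) = b"
      proof -
        have "(?p j - y j) mod int N = (?p j mod int N - y j) mod int N" by (simp add: mod_diff_left_eq)
        also have "\<dots> = (int (b * l) + k) mod int N"
          using pmod[OF j] by (simp add: unit_vec_def mod_diff_left_eq)
        also have "\<dots> = int (b * l) + k"
        proof (rule mod_pos_pos_trivial)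
          have "Suc b * l \<le> M * l" using bM by (intro mult_le_mono1) simp
          then have "b * l + l \<le> N" using M by simp
          then have "int (b * l) + int l \<le> int N" by (simp only: of_nat_add[symmetric] of_nat_le_iff)
          then show "int (b * l) + k < int N" using kl by linarith
        qed (use k in auto)
        finally show ?thesis using k kl by simp
      qed
      ultimately show False using unhit_disjoint[OF walk_avg, of x ?B ?blk j "{..<M}"] b by auto
    qed
    then show ?thesis using small[OF bM] by (intro exI[of _ "int (b * l)"]) auto
  qed
  moreover have "\<omega> \<in> space (srw_space d N)"
    by (cases \<omega>) (simp add: srw_space_def space_pair_measure space_PiM)
  ultimately show ?thesis unfolding vacant_event_def by blast
qed

text \<open>Union bound over the \<open>N ^ d\<close> points and \<open>d\<close> directions: for
  each pair, \<open>avg_torus_unhit\<close> inserts the initial delay and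
  \<open>wavg_all_hit_le\<close> bounds the probability that every block is hit.\<close>

lemma measure_vacant_ge:
  fixes d N s k k' V l M :: nat and \<eta> C K \<beta> t :: real
  defines "m \<equiv> 4 * d * N\<^sup>2"
  assumes d: "4 \<le> d" and N: "0 < N"
    and green: "\<And>j x y. j \<in> {1..d} \<Longrightarrow> (\<Sum>t<N ^ (d - 1).
      wavg (unit_steps d) t (\<lambda>w. of_bool (foldl vadd x w \<in> torus_line d N y j))) \<le> C"
    and \<eta>: "0 \<le> \<eta>" "\<eta> * C \<le> 1 / 2" and l: "0 < l" "\<lfloor>K * ln N\<rfloor> < int l"
    and s: "0 < s" "4 * (4 * real l / N) * s \<le> 1"
    and sizes: "s * m \<le> N ^ (d - 1)" "Suc k * m \<le> k' * N ^ (d - 1)"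
    and t: "t < real (k * m)" and M: "M * l \<le> N"
    and small: "\<And>b. b < M \<Longrightarrow> real (b * l) < N powr \<beta>"
  shows "1 - real N ^ d * real d * (exp (- (exp (- 4 * (4 * real l / N) * V) / s) * M) + 2 ^ k' / (1 + \<eta>) ^ V
      + Suc k * (2 / (1 + \<eta>) ^ s) + Suc k * exp (- (real N)\<^sup>2))
    \<le> measure (srw_space d N) (vacant_event d N K \<beta> t)"
proof -
  define \<epsilon> where "\<epsilon> = exp (- (exp (- 4 * (4 * real l / N) * V) / s) * M) + 2 ^ k' / (1 + \<eta>) ^ V
      + Suc k * (2 / (1 + \<eta>) ^ s) + Suc k * exp (- (real N)\<^sup>2)"
  let ?S = "unit_steps d" and ?n = "k * m"
  let ?blk = "\<lambda>y j z. {nat ((z - y j) mod int N div int l)} :: nat set"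
  let ?u = "\<lambda>y j k x w. unhit (torus_line d N y j) (?blk y j) j k x w {..<M}"
  have S: "finite ?S" "?S \<noteq> {}" using d unit_steps_nonempty[of d] by auto
  define bad where "bad = (\<lambda>x w. \<exists>(y, j)\<in>torus d N \<times> {1..d}. ?u y j 0 x w = {})"
  have "1 - avg (torus d N) (\<lambda>x. wavg ?S ?n (\<lambda>w. of_bool (bad x w))) \<le> measure (srw_space d N) (vacant_event d N K \<beta> t)"
  proof (rule measure_srw_ge[OF N _ vacant_event_measurable])
    fix x w and \<omega> :: "(nat \<Rightarrow> int) \<times> (nat \<Rightarrow> nat \<Rightarrow> int)"
    assume *: "length w = ?n" "\<not> bad x w" "fst \<omega> = x" "\<And>i. i < ?n \<Longrightarrow> snd \<omega> i = w ! i"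
    show "\<omega> \<in> vacant_event d N K \<beta> t"
      by (rule vacant_eventI[OF N, where x = x and w = w and l = l and M = M])
        (use * t l M small in \<open>auto simp: bad_def\<close>)
  qed (use d in simp)
  moreover have "avg (torus d N) (\<lambda>x. wavg ?S ?n (\<lambda>w. of_bool (bad x w))) \<le> real N ^ d * real d * \<epsilon>"
  proof -
    have "avg (torus d N) (\<lambda>x. wavg ?S ?n (\<lambda>w. of_bool (bad x w)))
        \<le> avg (torus d N) (\<lambda>x. wavg ?S ?n (\<lambda>w. \<Sum>(y, j)\<in>torus d N \<times> {1..d}. of_bool (?u y j 0 x w = {})))"
    proof (intro avg_mono wavg_mono)
      fix x w
      show "of_bool (bad x w) \<le> (\<Sum>(y, j)\<in>torus d N \<times> {1..d}. of_bool (?u y j 0 x w = {}) :: real)"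
      proof (cases "bad x w")
        case True
        then obtain y j where yj: "(y, j) \<in> torus d N \<times> {1..d}" "?u y j 0 x w = {}"
          unfolding bad_def by blast
        have "(\<lambda>(y, j). of_bool (?u y j 0 x w = {}) :: real) (y, j)
            \<le> (\<Sum>(y, j)\<in>torus d N \<times> {1..d}. of_bool (?u y j 0 x w = {}))"
          by (rule member_le_sum[OF yj(1)]) (auto simp: finite_torus)
        then show ?thesis using True yj(2) by simp
      qed (auto intro!: sum_nonneg)
    qed
    also have "\<dots> = (\<Sum>(y, j)\<in>torus d N \<times> {1..d}.
        avg (torus d N) (\<lambda>x. wavg ?S ?n (\<lambda>w. of_bool (?u y j 0 x w = {}))))"
      by (simp only: split_def avg_sum wavg_sum[OF finite_cartesian_product[OF finite_torus finite_atLeastAtMost]])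
    also have "\<dots> \<le> (\<Sum>(y, j)\<in>torus d N \<times> {1..d}. \<epsilon>)"
    proof (intro sum_mono, clarify)
      fix y j assume j: "j \<in> {1..d}"
      have "avg (torus d N) (\<lambda>x. wavg ?S ?n (\<lambda>w. of_bool (?u y j 0 x w = {})))
          = avg (torus d N) (\<lambda>x. wavg ?S (m + ?n) (\<lambda>w. of_bool (?u y j m x w = {})))"
      proof (rule avg_torus_unhit[OF N j])
        fix z z' assume "int N dvd z - z'"
        then have "(z - y j) mod int N = (z' - y j) mod int N" by (simp add: mod_eq_dvd_iff)
        then show "?blk y j z = ?blk y j z'" by simp
      qed
      also have "\<dots> \<le> avg (torus d N) (\<lambda>x. \<epsilon>)"
      proof (rule avg_mono)
        fix x
        have "wavg ?S (Suc k * m) (\<lambda>w. of_bool (?u y j m x w = {})) \<le>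
            exp (- (exp (- 4 * (4 * real l / N) * V) / s) * card {..<M}) + 2 ^ k' / (1 + \<eta>) ^ V
            + Suc k * (2 / (1 + \<eta>) ^ s) + Suc k * exp (- (real N)\<^sup>2)"
          unfolding m_def
        proof (rule wavg_all_hit_le[OF N j green[OF j] \<eta>])
          fix A n z assume "A \<subseteq> {..<M}" "N\<^sup>2 \<le> n"
          then show "walk_avg n (\<lambda>z. real (card (A \<inter> ?blk y j z))) z \<le> 4 * real l / N * card A"
            by (intro walk_avg_card_block_le[OF N l(1)]) (auto intro: finite_subset)
        qed (use s sizes in \<open>auto simp: m_def\<close>)
        then show "wavg ?S (m + ?n) (\<lambda>w. of_bool (?u y j m x w = {})) \<le> \<epsilon>"
          by (simp add: \<epsilon>_def)
      qed
      finally show "avg (torus d N) (\<lambda>x. wavg ?S ?n (\<lambda>w. of_bool (?u y j 0 x w = {}))) \<le> \<epsilon>"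
        by (simp add: avg_const[OF finite_torus torus_nonempty[OF N]])
    qed
    also have "\<dots> = real N ^ d * real d * \<epsilon>" by (simp add: card_torus card_cartesian_product)
    finally show ?thesis .
  qed
  ultimately show ?thesis unfolding \<epsilon>_def by linarith
qed

section \<open>Asymptotics of the error terms\<close>

text \<open>Half of the exponent absorbs the power of \<open>N\<close>.\<close>

lemma power_times_exp_neg_powr_tendsto_0:
  fixes a c :: real
  assumes "0 < a" "0 < c"
  shows "(\<lambda>N::nat. real N ^ D * exp (- (c * real N powr a))) \<longlonglongrightarrow> 0"
proof (rule tendsto_sandwich[OF _ _ tendsto_const])
  show "eventually (\<lambda>N::nat. 0 \<le> real N ^ D * exp (- (c * real N powr a))) at_top" by simp
  have "eventually (\<lambda>N::nat. (real D + 1) * ln N \<le> c / 2 * N powr a) at_top"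
    using assms by real_asymp
  moreover have "eventually (\<lambda>N::nat. 1 \<le> N) at_top" by (rule eventually_ge_at_top)
  ultimately show "eventually (\<lambda>N::nat. real N ^ D * exp (- (c * real N powr a)) \<le> exp (- (c / 2 * real N powr a))) at_top"
  proof eventually_elim
    case (elim N)
    have "0 \<le> ln (real N)" using elim by simp
    then have "real D * ln N \<le> c / 2 * N powr a" using elim(1) by (simp only: distrib_right)
    then have "exp (real D * ln N) * exp (- (c * real N powr a)) \<le> exp (c / 2 * N powr a) * exp (- (c * real N powr a))"
      by (intro mult_right_mono) auto
    moreover have "exp (real D * ln N) = real N ^ D" using elim by (simp add: exp_of_nat_mult)
    ultimately show ?case by (simp add: exp_add[symmetric] algebra_simps)
  qed
  show "(\<lambda>N::nat. exp (- (c / 2 * real N powr a))) \<longlonglongrightarrow> 0"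
    using assms by real_asymp
qed

text \<open>Budget for the exponent of \<open>N\<close>: out of \<beta>, the target takes \<beta>/8,
  the factor \<open>1 / s\<close> takes \<beta>/4 and the loss through visits \<beta>/4. The
  remaining 3\<beta>/8 must cover all lower-order terms.\<close>

lemma exponent_estimate:
  fixes \<beta> K c u :: real
  assumes "0 < \<beta>" "0 < K" "0 < c" "0 < u"
  shows "eventually (\<lambda>N::nat. ln 2 + 16 * c * u + 32 * c * (K * ln N + 1) / N + ln (K * ln N + 1)
    \<le> 3 * \<beta> / 8 * ln N) at_top"
  using assms by real_asymp

section \<open>Choice of the parameters\<close>

text \<open>The error terms stand, in order, for the coupon collector bound, too many visits in
  total, too many visits in one window, and too few moves in one period.\<close>

lemma vacant_probability_lower_bound:
  fixes d N c :: nat and K \<beta> u \<eta> C :: real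
  assumes d: "4 \<le> d" and K: "0 < K" and \<beta>: "0 < \<beta>" "\<beta> < 1" and N: "2 \<le> N"
    and green: "\<And>j x y. j \<in> {1..d} \<Longrightarrow> (\<Sum>t<N ^ (d - 1).
      wavg (unit_steps d) t (\<lambda>w. of_bool (foldl vadd x w \<in> torus_line d N y j))) \<le> C"
    and \<eta>: "0 < \<eta>" "\<eta> * C \<le> 1 / 2" "4 \<le> (1 + \<eta>) ^ c"
    and u: "0 < u" "16 * real c * K * u \<le> \<beta> / 4"
    and 1: "(N powr (\<beta> / 4) + 1) * (4 * real d) \<le> N"
    and 2: "1 + 8 * real d * (real N)\<^sup>2 \<le> real N ^ 3"
    and 3: "N powr \<beta> + (K * ln N + 1) \<le> N"
    and 4: "16 * (K * ln N + 1) * (N powr (\<beta> / 4) + 1) \<le> N"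
    and 5: "ln 2 + 16 * real c * u + 32 * real c * (K * ln N + 1) / N + ln (K * ln N + 1) \<le> 3 * \<beta> / 8 * ln N"
  shows "1 - real N ^ d * real d * (exp (- (N powr (\<beta> / 8))) + exp (- (u * ln 2 * N)) +
      (u * real N ^ d + 3) * (2 * exp (- (ln (1 + \<eta>) * N powr (\<beta> / 4)))) + (u * real N ^ d + 3) * exp (- (real N)\<^sup>2))
    \<le> measure (srw_space d N) (vacant_event d N K \<beta> (u * real N ^ d))"
proof -
  define s where "s = nat \<lceil>N powr (\<beta> / 4)\<rceil>"
  \<comment> \<open>The number of points of a segment.\<close>
  define l where "l = nat (\<lfloor>K * ln N\<rfloor> + 1)"
  \<comment> \<open>Rounded up, so that \<open>b < M\<close> holds exactly when
    \<open>b * l < N powr \<beta>\<close>.\<close>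
  define M where "M = nat \<lceil>N powr \<beta> / l\<rceil>"
  define m where "m = 4 * d * N\<^sup>2"
  \<comment> \<open>The added 1 makes \<open>k * m\<close> exceed \<open>u * N ^ d\<close> strictly:
    the position after the last step of a word is not observed.\<close>
  define k where "k = nat \<lceil>(u * N ^ d + 1) / m\<rceil>"
  \<comment> \<open>The number of Green function horizons of length \<open>N ^ (d - 1)\<close>; the
    added 1 leaves room for the initial delay and for rounding.\<close>
  define k' where "k' = nat \<lceil>u * N\<rceil> + 1"
  have N0: "0 < N" and lnN: "0 < ln (real N)" using N by auto
  have KN: "0 < K * ln N" using K lnN by simp
  have pow1: "1 \<le> N powr (\<beta> / 4)" using N \<beta> by (simp add: ge_one_powr_ge_zero)
  have s: "N powr (\<beta> / 4) \<le> s" "s \<le> N powr (\<beta> / 4) + 1" "0 < s"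
    unfolding s_def using pow1 by linarith+
  have l: "real l \<le> K * ln N + 1" "\<lfloor>K * ln N\<rfloor> < int l" "0 < l"
    unfolding l_def using KN by linarith+
  have M: "N powr \<beta> / l \<le> M" "M < N powr \<beta> / l + 1"
    using l(3) by (auto simp: M_def) linarith+
  have "0 < m" using d N by (simp add: m_def)
  then have m: "1 \<le> real m" "real m = 4 * d * (real N)\<^sup>2" by linarith (simp add: m_def)
  have uN: "0 < u * N ^ d" "0 < u * N" using u N by auto
  have "(u * N ^ d + 1) / m \<le> k" "k \<le> (u * N ^ d + 1) / m + 1"
  proof -
    have "0 < (u * N ^ d + 1) / m" using uN m by (intro divide_pos_pos) auto
    then show "(u * N ^ d + 1) / m \<le> k" "k \<le> (u * N ^ d + 1) / m + 1"
      unfolding k_def by linarith+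
  qed
  then have k: "u * N ^ d + 1 \<le> real k * m" "real k * m \<le> u * N ^ d + 1 + m"
    using m(1) by (auto simp: field_simps)
  have "(u * N ^ d + 1) / m \<le> u * N ^ d + 1" 
    using divide_left_mono[of 1 "real m" "u * N ^ d + 1"] m(1) uN by simp
  then have k3: "real (Suc k) \<le> u * N ^ d + 3"
    using \<open>k \<le> (u * N ^ d + 1) / m + 1\<close> by simp
  have k': "u * N + 1 \<le> k'" "k' \<le> u * N + 2" unfolding k'_def using uN by linarith+
  have N3: "real N ^ 3 \<le> real N ^ (d - 1)" using N d by (intro power_increasing) auto
  \<comment> \<open>With \<open>c\<close> visits allowed per horizon,
    \<open>(1 + \<eta>) ^ V \<ge> 4 ^ k'\<close> outweighs the factor \<open>2 ^ k'\<close> of the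
    tail bound.\<close>
  define V where "V = c * k'"
  define p where "p = 4 * real l / N"
  have bound: "1 - real N ^ d * real d * (exp (- (exp (- 4 * p * V) / s) * M) + 2 ^ k' / (1 + \<eta>) ^ V
      + Suc k * (2 / (1 + \<eta>) ^ s) + Suc k * exp (- (real N)\<^sup>2))
    \<le> measure (srw_space d N) (vacant_event d N K \<beta> (u * real N ^ d))"
    unfolding p_def
  proof (rule measure_vacant_ge[OF d N0 green _ \<eta>(2) l(3,2) s(3)])
    show "4 * (4 * real l / N) * s \<le> 1"
    proof -
      have "16 * real l * s \<le> 16 * (K * ln N + 1) * (N powr (\<beta> / 4) + 1)"
        using l s KN by (intro mult_mono) auto
      then show ?thesis using 4 N by (simp add: field_simps)
    qed
    have "real s * (4 * d) \<le> (N powr (\<beta> / 4) + 1) * (4 * d)" using s by (intro mult_right_mono) auto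
    then have "real s * (4 * d) \<le> N" using 1 by simp
    then have "real s * (4 * d) * (real N)\<^sup>2 \<le> N * (real N)\<^sup>2" by (intro mult_right_mono) auto
    then have "real (s * (4 * d * N\<^sup>2)) \<le> real N ^ (d - 1)"
      using N3 by (simp add: power3_eq_cube power2_eq_square mult_ac)
    then show "s * (4 * d * N\<^sup>2) \<le> N ^ (d - 1)" by (metis of_nat_le_iff of_nat_power)
    have Nd: "real N ^ d = real N * real N ^ (d - 1)" using d by (simp add: power_eq_if)
    have "real (Suc k * m) \<le> u * N ^ d + 1 + 2 * m" using k by (simp add: algebra_simps)
    also have "\<dots> \<le> u * N ^ d + real N ^ (d - 1)" using 2 N3 m by simp
    also have "\<dots> = (u * N + 1) * real N ^ (d - 1)" by (simp add: Nd algebra_simps)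
    also have "\<dots> \<le> real k' * real N ^ (d - 1)" using k' by (intro mult_right_mono) auto
    finally have "real (Suc k * m) \<le> real (k' * N ^ (d - 1))" by simp
    then show "Suc k * (4 * d * N\<^sup>2) \<le> k' * N ^ (d - 1)" unfolding m_def of_nat_le_iff .
    show "u * real N ^ d < real (k * (4 * d * N\<^sup>2))" using k by (simp add: m_def)
    have "real M * l \<le> (N powr \<beta> / l + 1) * l" using M by (intro mult_right_mono) auto
    also have "\<dots> = N powr \<beta> + l" using l by (simp add: field_simps)
    also have "\<dots> \<le> N" using 3 l by simp
    finally have "real (M * l) \<le> real N" by simp
    then show "M * l \<le> N" by (simp only: of_nat_le_iff)
    show "real (b * l) < N powr \<beta>" if "b < M" for b
    proof -
      have "real b + 1 \<le> M" using that by simp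
      then have "real b < N powr \<beta> / l" using M by linarith
      then show ?thesis using l by (simp add: field_simps)
    qed
  qed (use \<eta> in auto)
  \<comment> \<open>The main part of \<open>4 * p * V\<close> is
    \<open>16 * c * K * u * ln N\<close>, which the hypothesis on \<open>u\<close> bounds by
    \<open>\<beta> / 4 * ln N\<close>; hypothesis \<open>5\<close> absorbs the rest.\<close>
  have T1: "N powr (\<beta> / 8) \<le> exp (- 4 * p * V) / s * M"
  proof -
    have "4 * p * V = 16 * real c * (real l * (k' / N))" by (simp add: p_def V_def)
    also have "\<dots> \<le> 16 * real c * ((K * ln N + 1) * ((u * N + 2) / N))"
      using l k' KN uN by (intro mult_left_mono mult_mono divide_right_mono) auto
    also have "\<dots> = 16 * real c * K * u * ln N + 16 * real c * u + 32 * real c * (K * ln N + 1) / N"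
      using N by (simp add: field_simps)
    also have "\<dots> \<le> \<beta> / 4 * ln N + 16 * real c * u + 32 * real c * (K * ln N + 1) / N"
      using mult_right_mono[OF u(2)] lnN by simp
    finally have pV: "4 * p * V \<le> \<beta> / 4 * ln N + 16 * real c * u + 32 * real c * (K * ln N + 1) / N" .
    have powr: "N powr b = exp (b * ln N)" for b using N by (simp add: powr_def)
    have "s \<le> 2 * N powr (\<beta> / 4)" using s pow1 by linarith
    also have "\<dots> = exp (ln 2 + \<beta> / 4 * ln N)" by (simp add: powr exp_add)
    finally have s2: "s \<le> exp (ln 2 + \<beta> / 4 * ln N)" .
    have "exp (\<beta> * ln N - ln (K * ln N + 1)) = N powr \<beta> / (K * ln N + 1)"
      using KN by (simp add: powr exp_diff)
    also have "\<dots> \<le> N powr \<beta> / l" using l KN by (intro divide_left_mono) auto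
    finally have M2: "exp (\<beta> * ln N - ln (K * ln N + 1)) \<le> M" using M by linarith
    have "N powr (\<beta> / 8) \<le> exp (- (4 * p * V) - (ln 2 + \<beta> / 4 * ln N) + (\<beta> * ln N - ln (K * ln N + 1)))"
      unfolding powr exp_le_cancel_iff using 5 pV by linarith
    also have "\<dots> = exp (- 4 * p * V) / exp (ln 2 + \<beta> / 4 * ln N) * exp (\<beta> * ln N - ln (K * ln N + 1))"
      by (simp only: exp_add exp_diff) simp
    also have "\<dots> \<le> exp (- 4 * p * V) / s * M"
      using s2 s M2 by (intro mult_mono divide_left_mono) auto
    finally show ?thesis .
  qed
  have T2: "2 ^ k' / (1 + \<eta>) ^ V \<le> exp (- (u * ln 2 * N))"
  proof -
    have "(2::real) ^ k' * 2 ^ k' = 4 ^ k'" by (simp add: power_mult_distrib[symmetric])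
    also have "\<dots> \<le> ((1 + \<eta>) ^ c) ^ k'" using \<eta> by (intro power_mono) auto
    finally have "2 ^ k' * 2 ^ k' \<le> (1 + \<eta>) ^ V" by (simp add: V_def power_mult)
    then have "2 ^ k' / (1 + \<eta>) ^ V \<le> 1 / 2 ^ k'" using \<eta> by (simp add: field_simps)
    also have "\<dots> = exp (- (k' * ln 2))" by (simp add: exp_minus exp_of_nat_mult field_simps)
    also have "\<dots> \<le> exp (- (u * ln 2 * N))"
      using mult_right_mono[of "u * N" k' "ln 2"] k' by (simp add: mult_ac)
    finally show ?thesis .
  qed
  have T3: "2 / (1 + \<eta>) ^ s \<le> 2 * exp (- (ln (1 + \<eta>) * N powr (\<beta> / 4)))"
  proof -
    have "exp (ln (1 + \<eta>) * N powr (\<beta> / 4)) \<le> exp (s * ln (1 + \<eta>))"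
      using s \<eta> by (simp add: mult.commute mult_left_mono)
    also have "\<dots> = (1 + \<eta>) ^ s" using \<eta> by (simp add: exp_of_nat_mult)
    finally have e: "exp (ln (1 + \<eta>) * N powr (\<beta> / 4)) \<le> (1 + \<eta>) ^ s" .
    have "0 < 1 + \<eta>" using \<eta> by simp
    then have "2 / (1 + \<eta>) ^ s \<le> 2 / exp (ln (1 + \<eta>) * N powr (\<beta> / 4))"
      by (intro divide_left_mono e mult_pos_pos exp_gt_zero zero_less_power) simp
    then show ?thesis by (simp only: exp_minus divide_inverse)
  qed
  have "exp (- (exp (- 4 * p * V) / s) * M) + 2 ^ k' / (1 + \<eta>) ^ V
      + Suc k * (2 / (1 + \<eta>) ^ s) + Suc k * exp (- (real N)\<^sup>2)
    \<le> exp (- (N powr (\<beta> / 8))) + exp (- (u * ln 2 * N)) +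
      (u * real N ^ d + 3) * (2 * exp (- (ln (1 + \<eta>) * N powr (\<beta> / 4)))) + (u * real N ^ d + 3) * exp (- (real N)\<^sup>2)"
    using T1 T2 T3 k3 uN \<eta> by (intro add_mono mult_mono) auto
  then have "real N ^ d * real d * (exp (- (exp (- 4 * p * V) / s) * M) + 2 ^ k' / (1 + \<eta>) ^ V
      + Suc k * (2 / (1 + \<eta>) ^ s) + Suc k * exp (- (real N)\<^sup>2))
    \<le> real N ^ d * real d * (exp (- (N powr (\<beta> / 8))) + exp (- (u * ln 2 * N)) +
      (u * real N ^ d + 3) * (2 * exp (- (ln (1 + \<eta>) * N powr (\<beta> / 4)))) + (u * real N ^ d + 3) * exp (- (real N)\<^sup>2))"
    by (intro mult_left_mono) auto
  then show ?thesis using bound by linarith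
qed

theorem theorem1p2:
  fixes d :: nat and K \<beta> :: real
  assumes "d \<ge> 4" and "K > 0" and "0 < \<beta>" and "\<beta> < 1"
  shows "\<exists>u0::real. u0 > 0 \<and> (\<forall>u::real. 0 < u \<and> u \<le> u0 \<longrightarrow>
           (\<lambda>N::nat. measure (srw_space d N) (vacant_event d N K \<beta> (u * real N ^ d)))
             \<longlonglongrightarrow> 1)"
proof -
  obtain C where C: "0 < C" and green: "\<And>N j x y. 0 < N \<Longrightarrow> j \<in> {1..d} \<Longrightarrow> (\<Sum>t<N ^ (d - 1).
      wavg (unit_steps d) t (\<lambda>w. of_bool (foldl vadd x w \<in> torus_line d N y j))) \<le> C"
    using torus_line_green_bounded[OF assms(1)] by blast
  \<comment> \<open>The largest value that Khasminskii's argument allows for the bound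
    \<open>C\<close>; like \<open>C\<close>, it depends only on \<open>d\<close>.\<close>
  define \<eta> where "\<eta> = 1 / (2 * C)"
  have \<eta>: "0 < \<eta>" "\<eta> * C \<le> 1 / 2" using C by (auto simp: \<eta>_def)
  obtain c where c: "4 < (1 + \<eta>) ^ c" using real_arch_pow[of "1 + \<eta>" 4] \<eta> by auto
  then have c0: "0 < real c" by (cases c) auto
  define T where "T = (\<lambda>(D::nat) (b::real) (a::real) (N::nat). real N ^ D * exp (- (b * real N powr a)))"
  have T: "T D b a \<longlonglongrightarrow> 0" if "0 < a" "0 < b" for D a b
    unfolding T_def by (rule power_times_exp_neg_powr_tendsto_0[OF that])
  show ?thesis
  \<comment> \<open>Chosen so that \<open>16 * c * K * u \<le> \<beta> / 4\<close>. Since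
    \<open>c\<close> is determined by \<open>\<eta>\<close>, this bound on \<open>u\<close> depends
    only on \<open>d\<close>, \<open>K\<close> and \<open>\<beta>\<close>.\<close>
  proof (intro exI[of _ "\<beta> / (64 * real c * K)"] conjI allI impI)
    show "0 < \<beta> / (64 * real c * K)" using assms c0 by simp
    fix u assume u: "0 < u \<and> u \<le> \<beta> / (64 * real c * K)"
    then have u': "16 * real c * K * u \<le> \<beta> / 4" using assms c0 by (simp add: field_simps)
    \<comment> \<open>The bound of \<open>vacant_probability_lower_bound\<close>, expanded into
      multiples of terms \<open>T D b a\<close> that tend to 0.\<close>
    define L where "L = (\<lambda>N. 1 - (real d * T d 1 (\<beta> / 8) N + real d * T d (u * ln 2) 1 N +
      (2 * real d * u * T (2 * d) (ln (1 + \<eta>)) (\<beta> / 4) N + 6 * real d * T d (ln (1 + \<eta>)) (\<beta> / 4) N) +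
      (real d * u * T (2 * d) 1 2 N + 3 * real d * T d 1 2 N)))"
    have "L \<longlonglongrightarrow> 1 - (real d * 0 + real d * 0 + (2 * real d * u * 0 + 6 * real d * 0) + (real d * u * 0 + 3 * real d * 0))"
      unfolding L_def using assms u \<eta> by (intro tendsto_diff tendsto_add tendsto_mult tendsto_const T) auto
    then have L: "L \<longlonglongrightarrow> 1" by simp
    have "eventually (\<lambda>N::nat. (N powr (\<beta> / 4) + 1) * (4 * real d) \<le> N) at_top"
      using assms by real_asymp
    moreover have "eventually (\<lambda>N::nat. 1 + 8 * real d * (real N)\<^sup>2 \<le> real N ^ 3) at_top"
      using assms by real_asymp
    moreover have "eventually (\<lambda>N::nat. N powr \<beta> + (K * ln N + 1) \<le> N) at_top"
      using assms by real_asymp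
    moreover have "eventually (\<lambda>N::nat. 16 * (K * ln N + 1) * (N powr (\<beta> / 4) + 1) \<le> N) at_top"
      using assms by real_asymp
    moreover have "eventually (\<lambda>N::nat. ln 2 + 16 * real c * u + 32 * real c * (K * ln N + 1) / N + ln (K * ln N + 1)
        \<le> 3 * \<beta> / 8 * ln N) at_top"
      using assms c0 u by (intro exponent_estimate) auto
    moreover have "eventually (\<lambda>N::nat. 2 \<le> N) at_top" by (rule eventually_ge_at_top)
    ultimately have "eventually (\<lambda>N. L N \<le> measure (srw_space d N) (vacant_event d N K \<beta> (u * real N ^ d))) at_top"
    proof eventually_elim
      case (elim N)
      have "real N ^ (2 * d) = real N ^ d * real N ^ d" by (simp add: power_add mult_2)
      then have "L N = 1 - real N ^ d * real d * (exp (- (N powr (\<beta> / 8))) + exp (- (u * ln 2 * N)) +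
          (u * real N ^ d + 3) * (2 * exp (- (ln (1 + \<eta>) * N powr (\<beta> / 4)))) + (u * real N ^ d + 3) * exp (- (real N)\<^sup>2))"
        using elim by (simp add: L_def T_def algebra_simps)
      also have "\<dots> \<le> measure (srw_space d N) (vacant_event d N K \<beta> (u * real N ^ d))"
        using elim u u' \<eta> c assms by (intro vacant_probability_lower_bound[where C = C and c = c] green) auto
      finally show ?case by simp
    qed
    moreover have "eventually (\<lambda>N. measure (srw_space d N) (vacant_event d N K \<beta> (u * real N ^ d)) \<le> 1) at_top"
      by (simp add: prob_space.prob_le_1 prob_space_srw_space)
    ultimately show "(\<lambda>N. measure (srw_space d N) (vacant_event d N K \<beta> (u * real N ^ d))) \<longlonglongrightarrow> 1"
      using L by (rule tendsto_sandwich[OF _ _ _ tendsto_const])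
  qed
qed
end
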